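(* Let $(X_1,Y_1)\sim p_1$ and $(X_2,Y_2)\sim p_2$ be independent pairs of random variables, where $X_1,X_2$ take values in $\{0,1\}$ and $Y_1,Y_2$ take values in finite sets, and let $X_1+X_2$ be the sum modulo 2. For $\alpha>0$ put $$\delta_{1/\alpha}=2^{\frac{\alpha-1}{\alpha}},\qquad K^A_{1/\alpha}(X_i|Y_i)=e^{\frac{\alpha-1}{\alpha}H^A_\alpha(X_i|Y_i)}\quad(i=1,2).$$ For $\alpha\in(0,\tfrac13]\cup[\tfrac12,\infty)$, $$H^A_\alpha(X_2|X_1+X_2,Y_1Y_2)\ge H^A_\alpha(X_1|Y_1)+H^A_\alpha(X_2|Y_2)-\frac{\alpha}{\alpha-1}\log\left[\frac{\big(\delta_{1/\alpha}-K^A_{1/\alpha}(X_1|Y_1)\big)\big(\delta_{1/\alpha}-K^A_{1/\alpha}(X_2|Y_2)\big)}{1-\delta_{1/\alpha}}+\delta_{1/\alpha}\right],$$ where for $\alpha=1$ the subtracted term is understood as its limit: for $\alpha=1$ and $H_i=H^A_1(X_i|Y_i)$ the right-hand side is $H_1H_2/\log 2$. For $\alpha\in[\tfrac13,\tfrac12]$ the same holds with $\ge$ replaced by $\le$; in particular, for $\alpha\in\{\tfrac13,\tfrac12\}$ equality holds. These bounds are tight in the sense that equality is achieved when both $(X_1,Y_1)$ and $(X_2,Y_2)$ are given by binary erasure channels.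
   Context: For a joint distribution $p(x,y)$ on a finite product set and $\alpha\in(0,\infty)\setminus\{1\}$, the Arimoto conditional Rényi entropy is $$H^A_\alpha(X|Y)=\frac{\alpha}{1-\alpha}\log\sum_y p(y)\Big(\sum_x p(x|y)^\alpha\Big)^{1/\alpha},$$ with $\log$ the natural logarithm, $0^\alpha=0$ and terms with $p(y)=0$ omitted; for $\alpha=1$ it is defined as the limit $\alpha\to1$, i.e. the conditional Shannon entropy $H(X|Y)$. $H^A_\alpha(X_2|X_1+X_2,Y_1Y_2)$ is the entropy of $X_2$ conditioned on the triple $(X_1+X_2,Y_1,Y_2)$. A pair $(X,Y)$ is given by a binary erasure channel if $X$ is uniform on $\{0,1\}$ and, for some $\varepsilon\in[0,1]$, independently of $X$, $Y=X$ with probability $1-\varepsilon$ and $Y$ equals an erasure symbol with probability $\varepsilon$. *)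

theory Defs
  imports "HOL-Probability.Probability" "HOL-Library.Z2"
begin

text \<open>The type \<open>bit\<close> is the field with two elements, so its addition is the sum modulo 2.\<close>

instance bit :: finite
proof
  have "(UNIV :: bit set) = {0, 1}"
    using bit_not_zero_iff by auto
  then show "finite (UNIV :: bit set)"
    by (rule ssubst) simp
qed

definition cond_prob :: "('x \<times> 'y) pmf \<Rightarrow> 'x \<Rightarrow> 'y \<Rightarrow> real" where
  "cond_prob p x y = pmf p (x, y) / pmf (map_pmf snd p) y"

definition arimoto_formula :: "('x::finite \<times> 'y::finite) pmf \<Rightarrow> real \<Rightarrow> real" where
  "arimoto_formula p \<alpha> =
     \<alpha> / (1 - \<alpha>) * ln (\<Sum>y\<in>set_pmf (map_pmf snd p).
        pmf (map_pmf snd p) y * (\<Sum>x\<in>UNIV. cond_prob p x y powr \<alpha>) powr (1 / \<alpha>))"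

text \<open>
  The first component of the pair is the variable, the second one is the conditioning.
  The limit at order one exists and is the conditional Shannon entropy,
  see \<open>arimoto_formula_tendsto\<close> and \<open>arimoto_entropy_1\<close> below.
\<close>

definition arimoto_entropy :: "real \<Rightarrow> ('x::finite \<times> 'y::finite) pmf \<Rightarrow> real" where
  "arimoto_entropy \<alpha> p =
     (if \<alpha> = 1 then Lim (at 1) (arimoto_formula p) else arimoto_formula p \<alpha>)"

definition shannon_cond_entropy :: "('x::finite \<times> 'y::finite) pmf \<Rightarrow> real" where
  "shannon_cond_entropy p =
     - (\<Sum>y\<in>set_pmf (map_pmf snd p).
          pmf (map_pmf snd p) y * (\<Sum>x\<in>UNIV. cond_prob p x y * ln (cond_prob p x y)))"

definition arimoto_delta :: "real \<Rightarrow> real" where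
  "arimoto_delta \<alpha> = 2 powr ((\<alpha> - 1) / \<alpha>)"

definition arimoto_K :: "real \<Rightarrow> ('x::finite \<times> 'y::finite) pmf \<Rightarrow> real" where
  "arimoto_K \<alpha> p = exp ((\<alpha> - 1) / \<alpha> * arimoto_entropy \<alpha> p)"

definition correction_formula ::
  "(bit \<times> 'y1::finite) pmf \<Rightarrow> (bit \<times> 'y2::finite) pmf \<Rightarrow> real \<Rightarrow> real" where
  "correction_formula p1 p2 \<alpha> =
     \<alpha> / (\<alpha> - 1) *
       ln ((arimoto_delta \<alpha> - arimoto_K \<alpha> p1) * (arimoto_delta \<alpha> - arimoto_K \<alpha> p2)
             / (1 - arimoto_delta \<alpha>)
           + arimoto_delta \<alpha>)"

text \<open>The limit at order one exists, see \<open>correction_formula_tendsto\<close> below.\<close>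

definition correction_term ::
  "real \<Rightarrow> (bit \<times> 'y1::finite) pmf \<Rightarrow> (bit \<times> 'y2::finite) pmf \<Rightarrow> real" where
  "correction_term \<alpha> p1 p2 =
     (if \<alpha> = 1 then Lim (at 1) (correction_formula p1 p2) else correction_formula p1 p2 \<alpha>)"

text \<open>
  The joint distribution of \<open>X\<^sub>2\<close> and \<open>(X\<^sub>1 + X\<^sub>2, Y\<^sub>1, Y\<^sub>2)\<close>
  when \<open>(X\<^sub>1, Y\<^sub>1) \<sim> p\<^sub>1\<close> and \<open>(X\<^sub>2, Y\<^sub>2) \<sim> p\<^sub>2\<close> are independent.
\<close>

definition sum_given_pmf ::
  "(bit \<times> 'y1) pmf \<Rightarrow> (bit \<times> 'y2) pmf \<Rightarrow> (bit \<times> (bit \<times> 'y1 \<times> 'y2)) pmf" where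
  "sum_given_pmf p1 p2 =
     map_pmf (\<lambda>((x1, y1), (x2, y2)). (x2, (x1 + x2, y1, y2))) (pair_pmf p1 p2)"

text \<open>Binary erasure channel with uniform input; \<open>None\<close> is the erasure symbol.\<close>

definition bec_pmf :: "real \<Rightarrow> (bit \<times> bit option) pmf" where
  "bec_pmf \<epsilon> =
     map_pmf (\<lambda>(x, erased). (x, if erased then None else Some x))
       (pair_pmf (pmf_of_set UNIV) (bernoulli_pmf \<epsilon>))"


lemma cond_prob_nonneg: "cond_prob p x y \<ge> 0"
  by (simp add: cond_prob_def)

lemma sum_cond_prob:
  fixes p :: "('x::finite \<times> 'y::finite) pmf"
  assumes "y \<in> set_pmf (map_pmf snd p)"
  shows "(\<Sum>x\<in>UNIV. cond_prob p x y) = 1"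
proof -
  have eq: "snd -` {y} = (\<lambda>x. (x, y)) ` (UNIV :: 'x set)"
    by auto
  have "pmf (map_pmf snd p) y = measure p (snd -` {y})"
    by (simp add: pmf_map)
  also have "\<dots> = (\<Sum>z\<in>(\<lambda>x. (x, y)) ` UNIV. pmf p z)"
    unfolding eq by (rule measure_measure_pmf_finite) simp
  also have "\<dots> = (\<Sum>x\<in>UNIV. pmf p (x, y))"
    by (subst sum.reindex) (auto simp: inj_on_def)
  finally have "pmf (map_pmf snd p) y = (\<Sum>x\<in>UNIV. pmf p (x, y))" .
  moreover have "pmf (map_pmf snd p) y \<noteq> 0"
    using assms by (simp add: pmf_eq_0_set_pmf)
  ultimately show ?thesis
    by (simp add: cond_prob_def flip: sum_divide_distrib)
qed

lemma arimoto_formula_tendsto: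
  fixes p :: "('x::finite \<times> 'y::finite) pmf"
  shows "(arimoto_formula p \<longlongrightarrow> shannon_cond_entropy p) (at 1)"
proof -
  define S where "S = set_pmf (map_pmf snd p)"
  define P where "P = pmf (map_pmf snd p)"
  define q where "q = cond_prob p"
  define g where "g = (\<lambda>y a. \<Sum>x\<in>UNIV. q x y powr a)"
  define g' where "g' = (\<lambda>y. \<Sum>x\<in>UNIV. q x y * ln (q x y))"
  define f where "f = (\<lambda>a. \<Sum>y\<in>S. P y * g y a powr (1 / a))"
  have q: "((\<lambda>a. q x y powr a) has_real_derivative q x y * ln (q x y)) (at 1)" for x y
  proof (cases "q x y = 0")
    case False
    then have "q x y > 0"
      using cond_prob_nonneg[of p x y] by (simp add: q_def)
    then show ?thesis
      by (auto intro!: derivative_eq_intros simp: powr_def)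
  qed simp
  have g: "(g y has_real_derivative g' y) (at 1)" for y
    unfolding g_def g'_def by (intro DERIV_sum q)
  have g1: "g y 1 = 1" if "y \<in> S" for y
    using sum_cond_prob[of y p] that cond_prob_nonneg[of p _ y]
    by (simp add: g_def q_def S_def)
  have h: "((\<lambda>a. g y a powr (1 / a)) has_real_derivative g' y) (at 1)" if "y \<in> S" for y
  proof -
    have "((\<lambda>a::real. 1 / a) has_real_derivative -1) (at 1)"
      by (auto intro!: derivative_eq_intros)
    from DERIV_powr[OF g _ this, of y] show ?thesis
      using g1[OF that] by simp
  qed
  have f: "(f has_real_derivative (\<Sum>y\<in>S. P y * g' y)) (at 1)"
    unfolding f_def by (intro DERIV_sum DERIV_cmult h)
  have f1: "f 1 = 1"
    using sum_pmf_eq_1[of S "map_pmf snd p"] g1 by (simp add: f_def P_def S_def)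
  have "((\<lambda>a. ln (f a)) has_real_derivative (\<Sum>y\<in>S. P y * g' y)) (at 1)"
    using DERIV_ln_divide[of "f 1"] DERIV_chain2[OF _ f, of ln] f1 by fastforce
  then have "((\<lambda>a. (ln (f a) - ln (f 1)) / (a - 1)) \<longlongrightarrow> (\<Sum>y\<in>S. P y * g' y)) (at 1)"
    by (simp add: has_field_derivative_iff)
  then have "((\<lambda>a. - a * ((ln (f a) - ln (f 1)) / (a - 1))) \<longlongrightarrow> - 1 * (\<Sum>y\<in>S. P y * g' y)) (at 1)"
    by (intro tendsto_intros)
  moreover have "- a * ((ln (f a) - ln (f 1)) / (a - 1)) = arimoto_formula p a" for a
  proof -
    have neg: "a / (1 - a) = - (a / (a - 1))"
      by (metis minus_diff_eq minus_divide_right)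
    have "arimoto_formula p a = a / (1 - a) * ln (f a)"
      by (simp add: arimoto_formula_def f_def g_def P_def S_def q_def)
    also have "\<dots> = - a * (ln (f a) / (a - 1))"
      unfolding neg by simp
    finally show ?thesis
      using f1 by simp
  qed
  ultimately show ?thesis
    by (simp add: shannon_cond_entropy_def S_def P_def g'_def q_def)
qed

lemma arimoto_entropy_1: "arimoto_entropy 1 p = shannon_cond_entropy p"
  using tendsto_Lim[OF _ arimoto_formula_tendsto[of p]]
  by (simp add: arimoto_entropy_def)

lemma correction_formula_tendsto:
  fixes p1 :: "(bit \<times> 'y1::finite) pmf" and p2 :: "(bit \<times> 'y2::finite) pmf"
  defines "H1 \<equiv> arimoto_entropy 1 p1" and "H2 \<equiv> arimoto_entropy 1 p2"
  shows "(correction_formula p1 p2 \<longlongrightarrow> H1 + H2 - H1 * H2 / ln 2) (at 1)"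
proof -
  define t where "t = (\<lambda>a::real. (a - 1) / a)"
  have ev: "\<forall>\<^sub>F a in at (1::real). t a \<noteq> 0"
  proof -
    have "\<forall>\<^sub>F a in at (1::real). a \<in> {0<..} - {1}"
      by (rule eventually_at_in_open) auto
    then show ?thesis
      by eventually_elim (auto simp: t_def)
  qed
  have t0: "(t \<longlongrightarrow> 0) (at 1)"
    unfolding t_def by (auto intro!: tendsto_eq_intros)
  have quot: "((\<lambda>a. G (u a) / t a) \<longlongrightarrow> c) (at 1)"
    if G: "(G has_real_derivative 1) (at 0)" "G 0 = 0"
      and u: "((\<lambda>a. u a / t a) \<longlongrightarrow> c) (at 1)" for G u :: "real \<Rightarrow> real" and c
  proof -
    define \<phi> where "\<phi> = (\<lambda>v. if v = 0 then 1 else G v / v)"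
    have "((\<lambda>v. G v / v) \<longlongrightarrow> 1) (at 0)"
      using G by (simp add: has_field_derivative_iff)
    then have "(\<phi> \<longlongrightarrow> 1) (at 0)"
      by (rule Lim_transform_eventually) (auto simp: \<phi>_def eventually_at_filter)
    then have "isCont \<phi> 0"
      by (simp add: isCont_def \<phi>_def)
    moreover have "(u \<longlongrightarrow> 0) (at 1)"
    proof -
      have "((\<lambda>a. u a / t a * t a) \<longlongrightarrow> c * 0) (at 1)"
        by (intro tendsto_mult u t0)
      then have "((\<lambda>a. u a / t a * t a) \<longlongrightarrow> 0) (at 1)"
        by simp
      then show ?thesis
        by (rule Lim_transform_eventually) (use ev in eventually_elim, simp)
    qed
    ultimately have "((\<lambda>a. \<phi> (u a)) \<longlongrightarrow> \<phi> 0) (at 1)"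
      by (rule isCont_tendsto_compose)
    from tendsto_mult[OF this u] have "((\<lambda>a. \<phi> (u a) * (u a / t a)) \<longlongrightarrow> c) (at 1)"
      by (simp add: \<phi>_def)
    moreover have "\<phi> (u a) * (u a / t a) = G (u a) / t a" for a
      using G by (simp add: \<phi>_def)
    ultimately show ?thesis
      by (simp only:)
  qed
  have expq: "((\<lambda>a. (exp (t a * h a) - 1) / t a) \<longlongrightarrow> c) (at 1)"
    if "(h \<longlongrightarrow> c) (at 1)" for h c
  proof (rule quot[where G = "\<lambda>v. exp v - 1"])
    show "((\<lambda>v::real. exp v - 1) has_real_derivative 1) (at 0)"
      by (auto intro!: derivative_eq_intros)
    show "((\<lambda>a. t a * h a / t a) \<longlongrightarrow> c) (at 1)"
      using that by (rule Lim_transform_eventually) (use ev in eventually_elim, simp)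
  qed simp
  have Hlim: "((\<lambda>a. arimoto_entropy a p) \<longlongrightarrow> arimoto_entropy 1 p) (at 1)"
    for p :: "(bit \<times> 'y::finite) pmf"
    unfolding arimoto_entropy_1
    using arimoto_formula_tendsto[of p]
    by (rule Lim_transform_eventually) (auto simp: arimoto_entropy_def eventually_at_filter)
  define e0 where "e0 = (\<lambda>a. (arimoto_delta a - 1) / t a)"
  define e1 where "e1 = (\<lambda>a. (arimoto_K a p1 - 1) / t a)"
  define e2 where "e2 = (\<lambda>a. (arimoto_K a p2 - 1) / t a)"
  have e0: "(e0 \<longlongrightarrow> ln 2) (at 1)"
    using expq[OF tendsto_const[of "ln 2"]]
    by (simp add: e0_def arimoto_delta_def powr_def t_def)
  have e1: "(e1 \<longlongrightarrow> H1) (at 1)"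
    using expq[OF Hlim[of p1]] by (simp add: e1_def arimoto_K_def t_def H1_def)
  have e2: "(e2 \<longlongrightarrow> H2) (at 1)"
    using expq[OF Hlim[of p2]] by (simp add: e2_def arimoto_K_def t_def H2_def)
  define A where "A = (\<lambda>a. (arimoto_delta a - arimoto_K a p1) * (arimoto_delta a - arimoto_K a p2)
             / (1 - arimoto_delta a) + arimoto_delta a)"
  have "((\<lambda>a. e0 a - (e0 a - e1 a) * (e0 a - e2 a) / e0 a) \<longlongrightarrow>
          ln 2 - (ln 2 - H1) * (ln 2 - H2) / ln 2) (at 1)"
    by (intro tendsto_intros e0 e1 e2) simp
  moreover have "ln 2 - (ln 2 - H1) * (ln 2 - H2) / ln 2 = H1 + H2 - H1 * H2 / ln 2"
    by (simp add: field_simps)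
  moreover have "\<forall>\<^sub>F a in at 1. e0 a - (e0 a - e1 a) * (e0 a - e2 a) / e0 a = (A a - 1) / t a"
    using ev
  proof eventually_elim
    case (elim a)
    have d: "arimoto_delta a \<noteq> 1"
      using elim by (simp add: arimoto_delta_def t_def)
    have diffs: "e0 a - e1 a = (arimoto_delta a - arimoto_K a p1) / t a"
         "e0 a - e2 a = (arimoto_delta a - arimoto_K a p2) / t a"
      by (simp_all add: e0_def e1_def e2_def diff_divide_distrib)
    have frac: "x / s - (u / s) * (v / s) / (x / s) = (x - u * v / x) / s"
      if "x \<noteq> 0" "s \<noteq> 0" for x s u v :: real
      using that by (simp add: diff_divide_distrib)
    have neg: "w / (1 - x) = - (w / (x - 1))" for w x :: real
      by (metis minus_diff_eq minus_divide_right)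
    have A1: "A a - 1 = (arimoto_delta a - 1) -
        (arimoto_delta a - arimoto_K a p1) * (arimoto_delta a - arimoto_K a p2)
          / (arimoto_delta a - 1)"
      unfolding A_def neg by linarith
    have e0a: "e0 a = (arimoto_delta a - 1) / t a"
      by (simp add: e0_def)
    have nz: "arimoto_delta a - 1 \<noteq> 0"
      using d by simp
    show ?case
      unfolding diffs A1 unfolding e0a by (rule frac[OF nz elim])
  qed
  ultimately have lim: "((\<lambda>a. (A a - 1) / t a) \<longlongrightarrow> H1 + H2 - H1 * H2 / ln 2) (at 1)"
    by (auto intro: Lim_transform_eventually)
  have "((\<lambda>v::real. ln (1 + v)) has_real_derivative 1) (at 0)"
    by (auto intro!: derivative_eq_intros)
  from quot[OF this _ lim]
  have "((\<lambda>a. ln (A a) / t a) \<longlongrightarrow> H1 + H2 - H1 * H2 / ln 2) (at 1)"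
    by simp
  moreover have "ln (A a) / t a = correction_formula p1 p2 a" for a
    by (simp add: correction_formula_def A_def t_def)
  ultimately show ?thesis
    by simp
qed

end

theory Submission
  imports Defs
begin

text \<open>
  Put \<open>\<beta> = 1 / \<alpha>\<close>, \<open>D = 2\<^sup>\<beta> / 2\<close>, and let \<open>S\<close> be the argument of the logarithm in the Arimoto
  entropy. In terms of \<open>S\<close> the claim compares \<open>(D - 1) (S\<^sub>1\<^sub>2 - 1)\<close> with
  \<open>(S\<^sub>1 - 1) (S\<^sub>2 - 1)\<close>; both sides are linear in each of the two channels, so it suffices to
  fix \<open>y\<^sub>1\<close> and \<open>y\<^sub>2\<close>. Parametrising the two probabilities as \<open>c e\<^sup>\<beta>\<^sup>s\<close> and \<open>c e\<^sup>-\<^sup>\<beta>\<^sup>s\<close>, the claim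
  becomes \<open>f(0) (f(s + t) + f(s - t)) \<ge> 2 f(s) f(t)\<close> (or its reverse) for
  \<open>f(s) = (2 cosh s)\<^sup>\<beta> - 2 cosh (\<beta> s)\<close>. The difference of the two sides satisfies a wave equation
  with source proportional to \<open>f''(s) f(t) - f(s) f''(t)\<close> and vanishes to first order at
  \<open>t = 0\<close>, so its sign is that of the monotonicity of \<open>f'' / f\<close>. This in turn is decided by
  the sign of an elementary function on the unit interval which vanishes identically
  for \<open>\<beta> \<in> {1, 2, 3}\<close>, and the case \<open>\<alpha> = 1\<close> is obtained as a limit.
\<close>

subsection \<open>Sign conditions from derivatives\<close>

text \<open>A derivative that never turns negative after having been positive makes \<open>f\<close>
  quasiconvex: an interior value above both endpoint values would force, by two mean value steps, a
  positive slope on its left and a negative one on its right.\<close>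

lemma le_max_if_derivative_upcrossing:
  fixes f f' :: "real \<Rightarrow> real"
  assumes cont: "continuous_on {a..b} f"
    and deriv: "\<And>x. a < x \<Longrightarrow> x < b \<Longrightarrow> (f has_real_derivative f' x) (at x)"
    and up: "\<And>x y. a < x \<Longrightarrow> x < y \<Longrightarrow> y < b \<Longrightarrow> f' x > 0 \<Longrightarrow> f' y \<ge> 0"
    and x: "x \<in> {a..b}"
  shows "f x \<le> max (f a) (f b)"
proof (rule ccontr)
  assume "\<not> ?thesis"
  then have fx: "f a < f x" "f b < f x"
    by auto
  then have ab: "a < x" "x < b"
    using x by (auto simp: less_le)
  have "\<exists>l z. a < z \<and> z < x \<and> DERIV f z :> l \<and> f x - f a = (x - a) * l"
    using ab deriv by (intro MVT continuous_on_subset[OF cont])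
      (auto simp: real_differentiable_def, metis less_trans)
  then obtain z where z: "a < z" "z < x" "f x - f a = (x - a) * f' z"
    by (metis DERIV_unique ab(2) deriv less_trans)
  have "\<exists>l z. x < z \<and> z < b \<and> DERIV f z :> l \<and> f b - f x = (b - x) * l"
    using ab deriv by (intro MVT continuous_on_subset[OF cont])
      (auto simp: real_differentiable_def, metis less_trans)
  then obtain w where w: "x < w" "w < b" "f b - f x = (b - x) * f' w"
    by (metis DERIV_unique ab(1) deriv less_trans)
  have "f' z > 0"
    using z(3) fx ab by (smt (verit) mult_nonneg_nonpos)
  moreover have "f' w < 0"
    using w(3) fx ab by (smt (verit) mult_nonneg_nonneg)
  ultimately show False
    using up[of z w] z w by auto
qed

text \<open>Starting from zero, \<open>f'\<close> can become negative only after a point where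
  \<open>f''\<close> is nonpositive; from there on \<open>f'\<close> decreases and stays negative.
  So \<open>- f\<close> meets the upcrossing criterion and is bounded by its endpoint
  values.\<close>

lemma convex_then_concave_nonneg:
  fixes f f' f'' :: "real \<Rightarrow> real"
  assumes cont: "continuous_on {0..1} f" "continuous_on {0..1} f'"
    and deriv: "\<And>x. 0 < x \<Longrightarrow> x < 1 \<Longrightarrow> (f has_real_derivative f' x) (at x)"
      "\<And>x. 0 < x \<Longrightarrow> x < 1 \<Longrightarrow> (f' has_real_derivative f'' x) (at x)"
    and down: "\<And>x y. 0 < x \<Longrightarrow> x < y \<Longrightarrow> y < 1 \<Longrightarrow> f'' x \<le> 0 \<Longrightarrow> f'' y \<le> 0"
    and bd: "f 0 = 0" "f 1 = 0" "f' 0 = 0"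
    and x: "x \<in> {0..1}"
  shows "f x \<ge> 0"
proof -
  have "- f x \<le> max (- f 0) (- f 1)"
  proof (rule le_max_if_derivative_upcrossing[OF _ _ _ x])
    show "continuous_on {0..1} (\<lambda>x. - f x)"
      by (intro continuous_intros cont)
    show "((\<lambda>x. - f x) has_real_derivative - f' x) (at x)" if "0 < x" "x < 1" for x
      by (intro DERIV_minus deriv that)
    show "- f' y \<ge> 0" if xy: "0 < x" "x < y" "y < 1" "- f' x > 0" for x y
    proof -
      have "\<exists>l z. 0 < z \<and> z < x \<and> DERIV f' z :> l \<and> f' x - f' 0 = (x - 0) * l"
        using xy deriv(2) by (intro MVT continuous_on_subset[OF cont(2)])
          (auto simp: real_differentiable_def, metis less_trans)
      then obtain z where z: "0 < z" "z < x" "f' x - f' 0 = (x - 0) * f'' z"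
        by (metis DERIV_unique deriv(2) xy(2,3) less_trans)
      then have "x * f'' z < 0"
        using xy bd by auto
      then have "f'' z \<le> 0"
        using xy by (simp add: mult_less_0_iff)
      then have "f'' w \<le> 0" if "x \<le> w" "w \<le> y" for w
        using down[of z w] z that xy by auto
      then have "\<exists>d. DERIV f' w :> d \<and> d \<le> 0" if "x \<le> w" "w \<le> y" for w
        using deriv(2)[of w] that xy by fastforce
      then have "f' y \<le> f' x"
        using DERIV_nonpos_imp_nonincreasing[of x y f'] xy by simp
      then show ?thesis
        using xy by auto
    qed
  qed
  then show ?thesis
    using bd by auto
qed

text \<open>The last factor vanishes at 1, 2 and 3 and changes sign there together with the cubic;
  each of the four resulting intervals is treated separately. Up to sign it is the value of
  \<open>log_quot\<close> at 1.\<close>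

lemma ln_quadratic_sign:
  fixes b :: real
  assumes "b \<ge> 0"
  shows "(b - 1) * (b - 2) * (b - 3) * (b * ln 2 - ln (b\<^sup>2 - b + 2)) \<ge> 0"
proof -
  define l where "l = (\<lambda>b::real. b * ln 2 - ln (b\<^sup>2 - b + 2))"
  define n where "n = (\<lambda>b::real. ln 2 * (b\<^sup>2 - b + 2) - (2 * b - 1))"
  define l' where "l' = (\<lambda>b. n b / (b\<^sup>2 - b + 2))"
  have q: "b\<^sup>2 - b + 2 > 0" for b :: real
  proof -
    have "b\<^sup>2 - b + 2 = (b - 1/2)\<^sup>2 + 7/4"
      by (simp add: power2_eq_square algebra_simps)
    then show ?thesis
      by (smt (verit) zero_le_power2 divide_pos_pos)
  qed
  have l: "(l has_real_derivative l' b) (at b)" for b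
    unfolding l_def l'_def n_def using q[of b]
    by (auto intro!: derivative_eq_intros simp: field_simps)
  have c: "continuous_on T l" for T
    by (rule DERIV_continuous_on) (rule has_field_derivative_at_within[OF l])
  have l0: "l 0 = - ln 2" "l 1 = 0" "l 2 = 0" "l 3 = 0"
  proof -
    have "ln (4::real) = 2 * ln 2" "ln (8::real) = 3 * ln 2"
      using ln_realpow[of 2 2] ln_realpow[of 2 3] by simp_all
    then show "l 0 = - ln 2" "l 1 = 0" "l 2 = 0" "l 3 = 0"
      by (simp_all add: l_def)
  qed
  have sg: "l' b > 0 \<longleftrightarrow> n b > 0" "l' b < 0 \<longleftrightarrow> n b < 0" "l' b \<ge> 0 \<longleftrightarrow> n b \<ge> 0" "l' b \<le> 0 \<longleftrightarrow> n b \<le> 0" for b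
    using q[of b] by (simp_all add: l'_def zero_less_divide_iff divide_less_0_iff zero_le_divide_iff divide_le_0_iff)
  have L: "ln 2 \<ge> (2/3::real)" "ln 2 \<le> (25/36::real)"
    using ln2_ge_two_thirds ln2_le_25_over_36 by auto
  \<comment> \<open>The numerator \<open>n\<close> of \<open>l'\<close> is a convex quadratic, so
    being negative at 2 it changes sign at most once on each side of 2.\<close>
  have n2: "n 2 < 0"
    using L by (simp add: n_def)
  have convex: "n y * (z - x) \<le> n x * (z - y) + n z * (y - x)" if "x \<le> y" "y \<le> z" for x y z
  proof -
    have "n x * (z - y) + n z * (y - x) - n y * (z - x) = ln 2 * ((y - x) * (z - y) * (z - x))"
      unfolding n_def by (simp add: power2_eq_square algebra_simps)
    moreover have "... \<ge> 0" using that by auto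
    ultimately show ?thesis by linarith
  qed
  consider "b \<le> 1" | "1 \<le> b" "b \<le> 2" | "2 \<le> b" "b \<le> 3" | "3 \<le> b"
    by linarith
  then show ?thesis
  proof cases
    case 1
    \<comment> \<open>The quadratic is at least 7/4 and \<open>ln 2\<close> at least 2/3, so their
      product exceeds 1, which bounds \<open>2 * x - 1\<close>.\<close>
    have "n x \<ge> 0" if "0 < x" "x < 1" for x
    proof -
      have "x\<^sup>2 - x + 2 \<ge> 7/4"
        using zero_le_power2[of "x - 1/2"] by (simp add: power2_eq_square algebra_simps)
      then have "ln 2 * (x\<^sup>2 - x + 2) \<ge> 2/3 * (7/4)"
        using L by (intro mult_mono) auto
      then show ?thesis using that by (auto simp: n_def)
    qed
    then have "l b \<le> max (l 0) (l 1)"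
      using 1 assms by (intro le_max_if_derivative_upcrossing[OF c l]) (auto simp: sg)
    then have "l b \<le> 0" using L by (simp add: l0)
    moreover have "(b - 1) * (b - 2) * (b - 3) \<le> 0"
      using 1 by (auto simp: mult_le_0_iff zero_le_mult_iff)
    ultimately show ?thesis
      unfolding l_def by (rule mult_nonpos_nonpos[rotated])
  next
    case 2
    have "- l b \<le> max (- l 1) (- l 2)"
    proof (rule le_max_if_derivative_upcrossing[where f = "\<lambda>x. - l x" and f' = "\<lambda>x. - l' x"])
      show "continuous_on {1..2} (\<lambda>x. - l x)" by (intro continuous_intros c)
      show "((\<lambda>x. - l x) has_real_derivative - l' x) (at x)" for x by (intro DERIV_minus l)
      show "- l' y \<ge> 0" if "1 < x" "x < y" "y < 2" "- l' x > 0" for x y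
      proof -
        have "n x < 0" using that by (simp add: sg)
        then have "n x * (2 - y) + n 2 * (y - x) \<le> 0"
          using that n2 by (smt (verit) mult_nonneg_nonpos mult.commute)
        then have "n y * (2 - x) \<le> 0" using convex[of x y 2] that by auto
        then show ?thesis using that by (auto simp: sg mult_le_0_iff)
      qed
    qed (use 2 in auto)
    then have "l b \<ge> 0" by (simp add: l0)
    moreover have "(b - 1) * (b - 2) * (b - 3) \<ge> 0"
      using 2 by (auto simp: mult_le_0_iff zero_le_mult_iff)
    ultimately show ?thesis
      unfolding l_def by (rule mult_nonneg_nonneg[rotated])
  next
    case 3
    have "l b \<le> max (l 2) (l 3)"
    proof (rule le_max_if_derivative_upcrossing[OF c l])
      show "l' y \<ge> 0" if "2 < x" "x < y" "y < 3" "l' x > 0" for x y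
      proof (rule ccontr)
        assume "\<not> l' y \<ge> 0"
        then have "n x > 0" "n y < 0" using that by (simp_all add: sg not_le)
        moreover have "n x * (y - 2) \<le> n 2 * (y - x) + n y * (x - 2)"
          using convex[of 2 x y] that by auto
        moreover have "n 2 * (y - x) < 0" "n y * (x - 2) < 0" "n x * (y - 2) > 0"
          using that n2 calculation by (auto simp: mult_neg_pos)
        ultimately show False by linarith
      qed
    qed (use 3 in auto)
    then have "l b \<le> 0" by (simp add: l0)
    moreover have "(b - 1) * (b - 2) * (b - 3) \<le> 0"
      using 3 by (auto simp: mult_le_0_iff zero_le_mult_iff)
    ultimately show ?thesis
      unfolding l_def by (rule mult_nonpos_nonpos[rotated])
  next
    case 4
    have "n x \<ge> 0" if "3 \<le> x" for x
    proof -
      have "n x = n 3 + (x - 3) * (ln 2 * (x + 2) - 2)"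
        by (simp add: n_def power2_eq_square algebra_simps)
      moreover have "ln 2 * (x + 2) \<ge> 2/3 * 5"
        using L that by (intro mult_mono) auto
      moreover have "n 3 \<ge> 0" using L by (simp add: n_def)
      ultimately show ?thesis using that by simp
    qed
    then have "\<exists>y. DERIV l x :> y \<and> y \<ge> 0" if "3 \<le> x" for x
      using l that sg(3) by blast
    then have "l 3 \<le> l b"
      using DERIV_nonneg_imp_nondecreasing[OF 4, of l] by blast
    then have "l b \<ge> 0" by (simp add: l0)
    moreover have "(b - 1) * (b - 2) * (b - 3) \<ge> 0"
      using 4 by (auto simp: mult_le_0_iff zero_le_mult_iff)
    ultimately show ?thesis
      unfolding l_def by (rule mult_nonneg_nonneg[rotated])
  qed
qed

subsection \<open>The monotonicity function\<close>

context
  fixes b :: real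
begin

text \<open>\<open>quot_num\<close> and \<open>quot_den\<close> are the linear factors that remain
  in \<open>slope''\<close> beside \<open>x powr (b - 2)\<close> and
  \<open>(1 + x) powr (b - 2)\<close>.\<close>

definition quot_num :: "real \<Rightarrow> real" where
  "quot_num x = (b - 1)\<^sup>2 + (b + 1) * x"

definition quot_den :: "real \<Rightarrow> real" where
  "quot_den x = (3 - b) + (b + 1) * x"

text \<open>Passing to the logarithm makes the numerator of the derivative linear, see \<open>log_quot_deriv\<close>.\<close>

definition log_quot :: "real \<Rightarrow> real" where
  "log_quot x = ln (quot_num x) - ln (quot_den x) + (2 - b) * (ln (1 + x) - ln x)"

text \<open>
  Up to a positive factor, this is the derivative of \<open>excess_ratio\<close> at \<open>s\<close> with \<open>x = e\<^sup>-\<^sup>2\<^sup>s\<close>,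
  see \<open>excess_ratio_deriv\<close>.
\<close>

definition slope :: "real \<Rightarrow> real" where
  "slope x = (1 + x) powr b * (1 - x) - 1 + x powr (b + 1) + (1 - b) * (x - x powr b)"

definition slope' :: "real \<Rightarrow> real" where
  "slope' x = b * (1 + x) powr (b - 1) * (1 - x) - (1 + x) powr b + (b + 1) * x powr b
     + (1 - b) * (1 - b * x powr (b - 1))"

definition slope'' :: "real \<Rightarrow> real" where
  "slope'' x = b * (x powr (b - 2) * quot_num x - (1 + x) powr (b - 2) * quot_den x)"

lemma slope_deriv:
  assumes "0 < x"
  shows "(slope has_real_derivative slope' x) (at x)"
proof -
  have "(slope has_real_derivative
      (b * (1 + x) powr (b - 1)) * (1 - x) + (1 + x) powr b * (- 1) - 0 + (b + 1) * x powr (b + 1 - 1)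
     + (1 - b) * (1 - b * x powr (b - 1))) (at x)"
    unfolding slope_def using assms
    by (auto intro!: derivative_eq_intros simp: powr_diff)
  then show ?thesis
    by (simp add: slope'_def)
qed

lemma slope'_deriv:
  assumes "0 < x"
  shows "(slope' has_real_derivative slope'' x) (at x)"
proof -
  have *: "x powr (b - 1) = x * x powr (b - 2)" "(1 + x) powr (b - 1) = (1 + x) * (1 + x) powr (b - 2)"
    using assms powr_mult_base[of x "b - 2"] powr_mult_base[of "1 + x" "b - 2"] by simp_all
  have p: "((\<lambda>x. x powr c) has_real_derivative c * x powr (c - 1)) (at x)"
    "((\<lambda>x. (1 + x) powr c) has_real_derivative c * (1 + x) powr (c - 1)) (at x)" for c
    using assms by (auto intro!: has_real_derivative_powr derivative_eq_intros simp: powr_diff)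
  have "(slope' has_real_derivative
      b * ((b - 1) * (1 + x) powr (b - 1 - 1)) * (1 - x) - b * (1 + x) powr (b - 1) - b * (1 + x) powr (b - 1)
     + (b + 1) * (b * x powr (b - 1)) + (1 - b) * (- (b * ((b - 1) * x powr (b - 1 - 1))))) (at x)"
    unfolding slope'_def
    by (rule DERIV_cong, (rule p DERIV_add DERIV_diff DERIV_mult DERIV_const DERIV_ident)+) simp
  then have "(slope' has_real_derivative
      b * ((b - 1) * (1 + x) powr (b - 2)) * (1 - x) - b * (1 + x) powr (b - 1) - b * (1 + x) powr (b - 1)
     + (b + 1) * (b * x powr (b - 1)) + (1 - b) * (- (b * ((b - 1) * x powr (b - 2))))) (at x)"
    by simp
  also have "b * ((b - 1) * (1 + x) powr (b - 2)) * (1 - x) - b * (1 + x) powr (b - 1) - b * (1 + x) powr (b - 1)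
     + (b + 1) * (b * x powr (b - 1)) + (1 - b) * (- (b * ((b - 1) * x powr (b - 2)))) = slope'' x"
    unfolding slope''_def * quot_num_def quot_den_def by (simp add: power2_eq_square algebra_simps)
  finally show ?thesis .
qed

text \<open>The only zero in \<open>x\<close> of the linear factor is
  \<open>(b - 1) / (b + 1)\<close>. It is negative for \<open>0 < b < 1\<close>, where
  \<open>log_quot\<close> is monotone, and lies in the unit interval for \<open>b > 1\<close>, where
  \<open>log_quot\<close> has at most one turning point.\<close>

lemma log_quot_deriv:
  assumes "0 < x" "quot_den x > 0" "quot_num x > 0"
  shows "(log_quot has_real_derivative
    (2 - b) * (b - 1) * (3 - b) * ((b + 1) * x - (b - 1)) / (quot_num x * quot_den x * (x * (1 + x)))) (at x)"
proof -
  have frac: "c / A - c / B + d * (1 / y - 1 / x) = (c * (B - A) * (x * y) + d * (x - y) * (A * B)) / (A * B * (x * y))"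
    if "A > 0" "B > 0" "y > 0" for A B c d y :: real
    using that assms(1) by (simp add: field_simps)
  have "(log_quot has_real_derivative
     (b + 1) / quot_num x - (b + 1) / quot_den x + (2 - b) * (1 / (1 + x) - 1 / x)) (at x)"
    using assms unfolding log_quot_def quot_num_def quot_den_def
    by (auto intro!: derivative_eq_intros)
  also have "(b + 1) / quot_num x - (b + 1) / quot_den x + (2 - b) * (1 / (1 + x) - 1 / x) =
     ((b + 1) * (quot_den x - quot_num x) * (x * (1 + x)) + (2 - b) * (x - (1 + x)) * (quot_num x * quot_den x))
       / (quot_num x * quot_den x * (x * (1 + x)))"
    using assms by (intro frac) auto
  also have "(b + 1) * (quot_den x - quot_num x) * (x * (1 + x)) + (2 - b) * (x - (1 + x)) * (quot_num x * quot_den x)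
     = (2 - b) * (b - 1) * (3 - b) * ((b + 1) * x - (b - 1))"
    unfolding quot_num_def quot_den_def by (simp add: power2_eq_square algebra_simps)
  finally show ?thesis .
qed

text \<open>Both products in \<open>slope''\<close> are positive here, and \<open>log_quot\<close>
  is the logarithm of their ratio.\<close>

lemma slope''_sign:
  assumes "0 < x" "quot_den x > 0" "quot_num x > 0" "b > 0"
  shows "slope'' x \<le> 0 \<longleftrightarrow> log_quot x \<le> 0" "slope'' x \<ge> 0 \<longleftrightarrow> log_quot x \<ge> 0"
proof -
  have "log_quot x = ln (x powr (b - 2) * quot_num x) - ln ((1 + x) powr (b - 2) * quot_den x)"
    using assms by (simp add: log_quot_def ln_mult ln_powr algebra_simps)
  moreover have "x powr (b - 2) * quot_num x > 0" "(1 + x) powr (b - 2) * quot_den x > 0"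
    using assms by auto
  ultimately show "slope'' x \<le> 0 \<longleftrightarrow> log_quot x \<le> 0" "slope'' x \<ge> 0 \<longleftrightarrow> log_quot x \<ge> 0"
    using assms(4) by (simp_all add: slope''_def mult_le_0_iff zero_le_mult_iff)
qed

lemma log_quot_1:
  assumes "b > 0"
  shows "(b - 1) * (b - 2) * (b - 3) * log_quot 1 \<le> 0"
proof -
  have "ln (4::real) = 2 * ln 2"
    using ln_realpow[of 2 2] by simp
  then have "log_quot 1 = - (b * ln 2 - ln (b\<^sup>2 - b + 2))"
    by (simp add: log_quot_def quot_num_def quot_den_def power2_eq_square algebra_simps)
  then show ?thesis
    using ln_quadratic_sign[of b] assms by (simp only: mult_minus_right) simp
qed

section \<open>Sign of the slope function on the unit interval\<close>

lemma slope_0_1 [simp]: "slope 0 = 0" "slope 1 = 0"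
  by (simp_all add: slope_def)

lemma slope_continuous:
  assumes "b > 0"
  shows "continuous_on {0..1} slope"
  unfolding slope_def using assms by (intro continuous_intros continuous_on_powr') auto

lemma slope_nonpos:
  assumes "0 < b" "b < 1" "x \<in> {0..1}"
  shows "slope x \<le> 0"
proof -
  have pos: "quot_num y > 0" "quot_den y > 0" if "0 < y" for y
    using that assms by (auto simp: quot_num_def quot_den_def intro!: add_nonneg_pos add_pos_pos)
  have nonneg: "slope'' y \<ge> 0" if y: "0 < y" "y < 1" for y
  proof -
    have "\<exists>d. (log_quot has_real_derivative d) (at z) \<and> d \<le> 0" if z: "y \<le> z" "z \<le> 1" for z
    proof -
      have "z > 0" using z y by auto
      then have "quot_num z * quot_den z * (z * (1 + z)) > 0"
        using pos[of z] by simp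
      moreover have "(2 - b) * (b - 1) * (3 - b) * ((b + 1) * z - (b - 1)) \<le> 0"
      proof -
        have "(2 - b) * (b - 1) * (3 - b) \<le> 0"
          using assms by (intro mult_nonpos_nonneg mult_nonneg_nonpos) auto
        moreover have "(b + 1) * z - (b - 1) \<ge> 0"
          using assms \<open>z > 0\<close> by (smt (verit) mult_nonneg_nonneg)
        ultimately show ?thesis
          by (rule mult_nonpos_nonneg)
      qed
      ultimately show ?thesis
        using log_quot_deriv[of z] pos[of z] \<open>z > 0\<close> divide_nonpos_pos by blast
    qed
    then have "log_quot 1 \<le> log_quot y"
      using DERIV_nonpos_imp_nonincreasing[of y 1 log_quot] y by simp
    moreover have "log_quot 1 \<ge> 0"
    proof -
      have "(b - 1) * (b - 2) * (b - 3) < 0"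
        using assms by (simp add: mult_less_0_iff zero_less_mult_iff)
      then show ?thesis
        using log_quot_1 assms by (smt (verit) mult_neg_neg)
    qed
    ultimately show ?thesis
      using slope''_sign[of y] y pos[of y] assms by auto
  qed
  have "slope x \<le> max (slope 0) (slope 1)"
  proof (rule le_max_if_derivative_upcrossing[OF slope_continuous slope_deriv])
    show "slope' z \<ge> 0" if yz: "0 < y" "y < z" "z < 1" "slope' y > 0" for y z
    proof -
      have "\<exists>d. (slope' has_real_derivative d) (at w) \<and> d \<ge> 0" if "y \<le> w" "w \<le> z" for w
        using slope'_deriv[of w] nonneg[of w] that yz by auto
      then have "slope' y \<le> slope' z"
        using DERIV_nonneg_imp_nondecreasing[of y z slope'] yz by simp
      then show ?thesis using yz by simp
    qed
  qed (use assms in auto)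
  then show ?thesis by simp
qed

text \<open>The function \<open>\<sigma> * slope\<close> is first convex, then concave: to the right
  of a point where \<open>\<sigma> * slope''\<close> is nonpositive,
  \<open>\<sigma> * log_quot\<close> is quasiconvex, and it is nonpositive both at that point and at
  1.\<close>

lemma slope_sign_gt_1:
  assumes "b > 1" and \<sigma>: "\<sigma> \<in> {1, -1}" "\<sigma> * ((b - 2) * (b - 3)) > 0" and x: "x \<in> {0..1}"
  shows "\<sigma> * slope x \<ge> 0"
proof (rule convex_then_concave_nonneg[where f = "\<lambda>x. \<sigma> * slope x" and f' = "\<lambda>x. \<sigma> * slope' x"
      and f'' = "\<lambda>x. \<sigma> * slope'' x", OF _ _ _ _ _ _ _ _ x])
  show "continuous_on {0..1} (\<lambda>x. \<sigma> * slope x)"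
    using assms by (intro continuous_intros slope_continuous) auto
  show "continuous_on {0..1} (\<lambda>x. \<sigma> * slope' x)"
  proof -
    have "continuous_on {0..1} (\<lambda>x::real. x powr c)" "continuous_on {0..1} (\<lambda>x::real. (1 + x) powr c)" if "c > 0" for c
      using that by (intro continuous_on_powr' continuous_intros; auto)+
    then show ?thesis
      unfolding slope'_def using assms
      by (intro continuous_on_mult continuous_on_add continuous_on_diff continuous_on_const continuous_on_id) auto
  qed
  show "((\<lambda>x. \<sigma> * slope x) has_real_derivative \<sigma> * slope' x) (at x)" if "0 < x" for x
    by (intro DERIV_cmult slope_deriv that)
  show "((\<lambda>x. \<sigma> * slope' x) has_real_derivative \<sigma> * slope'' x) (at x)" if "0 < x" for x
    by (intro DERIV_cmult slope'_deriv that)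
  show "\<sigma> * slope' 0 = 0"
    using assms by (simp add: slope'_def)
  show "\<sigma> * slope'' y \<le> 0" if xy: "0 < x" "x < y" "y < 1" "\<sigma> * slope'' x \<le> 0" for x y
  proof -
    have num: "quot_num z > 0" if "0 < z" for z
      using that assms by (auto simp: quot_num_def intro!: add_nonneg_pos)
    \<comment> \<open>For \<open>b > 3\<close> this factor may be nonpositive near zero, but then
      \<open>slope''\<close> is positive, against the assumption on \<open>x\<close>. For
      \<open>\<sigma> = -1\<close> one has \<open>2 < b < 3\<close>.\<close>
    have "quot_den x > 0"
    proof (cases "\<sigma> = 1")
      case True
      show ?thesis
      proof (rule ccontr)
        assume "\<not> ?thesis"
        then have "(1 + x) powr (b - 2) * quot_den x \<le> 0"
          by (simp add: mult_nonneg_nonpos)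
        moreover have "x powr (b - 2) * quot_num x > 0"
          using num[of x] xy by simp
        ultimately have "b * (x powr (b - 2) * quot_num x - (1 + x) powr (b - 2) * quot_den x) > 0"
          using assms by (intro mult_pos_pos) auto
        then show False
          using xy True by (simp add: slope''_def)
      qed
    next
      case False
      then have "(b - 2) * (b - 3) < 0" using \<sigma> by auto
      then have "b < 3" using assms by (auto simp: mult_less_0_iff)
      then show ?thesis
        using assms xy by (simp add: quot_den_def add_pos_pos)
    qed
    moreover have "quot_den x \<le> quot_den z" if "x \<le> z" for z
      using that assms by (simp add: quot_den_def)
    ultimately have den: "quot_den z > 0" if "x \<le> z" for z
      using that by force
    have deriv: "(log_quot has_real_derivative
      (2 - b) * (b - 1) * (3 - b) * ((b + 1) * z - (b - 1)) / (quot_num z * quot_den z * (z * (1 + z)))) (at z)"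
      if "x \<le> z" for z
      using that xy by (intro log_quot_deriv num den) auto
    have "\<sigma> * log_quot y \<le> max (\<sigma> * log_quot x) (\<sigma> * log_quot 1)"
    proof (rule le_max_if_derivative_upcrossing[where f = "\<lambda>z. \<sigma> * log_quot z"
        and f' = "\<lambda>z. \<sigma> * ((2 - b) * (b - 1) * (3 - b) * ((b + 1) * z - (b - 1)) / (quot_num z * quot_den z * (z * (1 + z))))"])
      show "((\<lambda>z. \<sigma> * log_quot z) has_real_derivative
        \<sigma> * ((2 - b) * (b - 1) * (3 - b) * ((b + 1) * z - (b - 1)) / (quot_num z * quot_den z * (z * (1 + z))))) (at z)"
        if "x < z" for z
        using that by (intro DERIV_cmult deriv) auto
      show "continuous_on {x..1} (\<lambda>z. \<sigma> * log_quot z)"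
        by (intro continuous_intros DERIV_continuous_on[OF has_field_derivative_at_within[OF deriv]]) auto
      \<comment> \<open>\<open>k\<close> collects the factors independent of \<open>z\<close>; the
        derivative then has the sign of \<open>(b + 1) * z - (b - 1)\<close>, which increases in
        \<open>z\<close>.\<close>
      define k where "k = \<sigma> * ((b - 2) * (b - 3)) * (b - 1)"
      have k: "k > 0" using assms by (simp add: k_def)
      have sg: "\<sigma> * ((2 - b) * (b - 1) * (3 - b) * ((b + 1) * z - (b - 1)) / (quot_num z * quot_den z * (z * (1 + z))))
        = k * ((b + 1) * z - (b - 1)) / (quot_num z * quot_den z * (z * (1 + z)))" for z
        by (simp add: k_def algebra_simps)
      have pos: "quot_num z * quot_den z * (z * (1 + z)) > 0" if "x < z" for z
        using num[of z] den[of z] that xy by simp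
      show "\<sigma> * ((2 - b) * (b - 1) * (3 - b) * ((b + 1) * w - (b - 1)) / (quot_num w * quot_den w * (w * (1 + w)))) \<ge> 0"
        if zw: "x < z" "z < w" "w < 1"
          "\<sigma> * ((2 - b) * (b - 1) * (3 - b) * ((b + 1) * z - (b - 1)) / (quot_num z * quot_den z * (z * (1 + z)))) > 0" for z w
      proof -
        have "k * ((b + 1) * z - (b - 1)) > 0"
          using zw(4) pos[OF zw(1)] unfolding sg by (metis divide_nonpos_pos not_le)
        then have "(b + 1) * z - (b - 1) > 0"
          using k by (rule zero_less_mult_pos)
        moreover have "(b + 1) * z \<le> (b + 1) * w"
          using zw assms by simp
        ultimately have "k * ((b + 1) * w - (b - 1)) \<ge> 0"
          using k by simp
        then show ?thesis
          unfolding sg using pos[of w] zw by (intro divide_nonneg_pos) auto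
      qed
      show "y \<in> {x..1}" using xy by auto
    qed
    moreover have "\<sigma> * log_quot x \<le> 0"
      using slope''_sign[of x] xy den[of x] num[of x] assms by auto
    moreover have "\<sigma> * log_quot 1 \<le> 0"
    proof -
      have "(b - 1) * (b - 2) * (b - 3) * log_quot 1 = (\<sigma> * ((b - 2) * (b - 3)) * (b - 1)) * (\<sigma> * log_quot 1)"
        using \<sigma>(1) by auto
      moreover have "\<sigma> * ((b - 2) * (b - 3)) * (b - 1) > 0"
        using assms by simp
      ultimately show ?thesis
        using log_quot_1 assms by (smt (verit) mult_pos_pos)
    qed
    ultimately have "\<sigma> * log_quot y \<le> 0" by linarith
    then show ?thesis
      using slope''_sign[of y] xy den[of y] num[of y] assms by auto
  qed
qed simp_all

text \<open>The multiplier \<open>\<theta>\<close> treats both directions of the inequality at once.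
  It is arbitrary for \<open>b\<close> equal to 2 or 3, where \<open>slope\<close> vanishes on the
  unit interval. The factor \<open>b - 1\<close> compensates the change of sign of
  \<open>slope\<close> at \<open>b = 1\<close>.\<close>

lemma slope_sign:
  assumes b: "b > 0" and \<theta>: "\<theta> * ((b - 2) * (b - 3)) \<ge> 0" and x: "x \<in> {0..1}"
  shows "\<theta> * ((b - 1) * slope x) \<ge> 0"
proof -
  consider "b < 1" | "b = 1" | "b = 2" | "b = 3" | "b > 1" "b \<noteq> 2" "b \<noteq> 3" by linarith
  then show ?thesis
  proof cases
    case 1
    then have "(b - 1) * slope x \<ge> 0"
      using slope_nonpos b x by (simp add: mult_nonpos_nonpos)
    moreover have "(b - 2) * (b - 3) > 0"
      using 1 by (simp add: zero_less_mult_iff)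
    then have "\<theta> \<ge> 0" using \<theta> by (simp add: zero_le_mult_iff)
    ultimately show ?thesis by simp
  next
    case 3
    have "x powr 2 = x ^ 2" "x powr 3 = x ^ 3" "(1 + x) powr 2 = (1 + x) ^ 2"
      using x by (cases "x = 0"; simp)+
    then have "slope x = 0"
      unfolding slope_def unfolding 3 by (simp add: eval_nat_numeral algebra_simps)
    then show ?thesis by simp
  next
    case 4
    have "x powr 4 = x ^ 4" "x powr 3 = x ^ 3" "(1 + x) powr 3 = (1 + x) ^ 3"
      using x by (cases "x = 0"; simp)+
    then have "slope x = 0"
      unfolding slope_def unfolding 4 by (simp add: eval_nat_numeral algebra_simps)
    then show ?thesis by simp
  next
    case 5
    define \<sigma> :: real where "\<sigma> = sgn ((b - 2) * (b - 3))"
    have nz: "(b - 2) * (b - 3) \<noteq> 0" using 5 by simp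
    have \<sigma>: "\<sigma> \<in> {1, -1}" "\<sigma> * ((b - 2) * (b - 3)) > 0"
      unfolding \<sigma>_def mult.commute[of "sgn _"] using nz linorder_less_linear[of "(b - 2) * (b - 3)" 0]
      by (auto simp only: sgn_if split: if_splits)
    have "\<theta> * \<sigma> \<ge> 0"
    proof -
      have "(\<theta> * \<sigma>) * (\<sigma> * ((b - 2) * (b - 3))) \<ge> 0"
        using \<theta> \<sigma>(1) by auto
      then show ?thesis using \<sigma>(2) by (simp only: zero_le_mult_iff) auto
    qed
    moreover have "\<sigma> * slope x \<ge> 0"
      using slope_sign_gt_1[OF 5(1) \<sigma> x] .
    ultimately have "(\<theta> * \<sigma>) * (\<sigma> * slope x) * (b - 1) \<ge> 0"
      using 5 by simp
    then show ?thesis using \<sigma>(1) by (auto simp: algebra_simps)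
  qed simp
qed

end

subsection \<open>The addition inequality\<close>

text \<open>The expression \<open>w\<close> in the conclusion, without \<open>\<theta>\<close>,
  satisfies \<open>w_tt - w_ss = 2 * (f'' s * f t - f s * f'' t)\<close>, and
  \<open>w = w_t = 0\<close> at \<open>t = 0\<close>, the latter by \<open>f' 0 = 0\<close>. Hence
  it is the integral of half the source over the characteristic triangle (d'Alembert). As
  \<open>t \<le> s\<close>, every point \<open>(y, z)\<close> of that triangle has
  \<open>0 \<le> z \<le> y\<close>, where \<open>mono\<close> applies.\<close>

lemma addition_inequality_if_log_derivative_mono:
  fixes f f' f'' :: "real \<Rightarrow> real"
  assumes f: "\<And>x. (f has_real_derivative f' x) (at x)"
    and f': "\<And>x. (f' has_real_derivative f'' x) (at x)"
    and f'0: "f' 0 = 0"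
    and mono: "\<And>x y. 0 \<le> x \<Longrightarrow> x \<le> y \<Longrightarrow> \<theta> * (f'' y * f x - f y * f'' x) \<ge> 0"
    and st: "0 \<le> t" "t \<le> s"
  shows "\<theta> * (f 0 * (f (s + t) + f (s - t)) - 2 * f s * f t) \<ge> 0"
proof -
  \<comment> \<open>All arguments of \<open>g\<close> below lie between 0 and \<open>s + t\<close>;
    the margin of one makes its derivative two-sided at these ends as well.\<close>
  have "continuous_on {-1..s + t + 1} f"
    by (rule DERIV_continuous_on[OF has_field_derivative_at_within[OF f]])
  then obtain g where "\<And>x. x \<in> {-1..s + t + 1} \<Longrightarrow> (g has_vector_derivative f x) (at x within {-1..s + t + 1})"
    using antiderivative_continuous by blast
  then have g: "(g has_real_derivative f x) (at x)" if "-1 < x" "x < s + t + 1" for x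
    using that at_within_Icc_at[of "-1" x "s + t + 1"]
    by (metis atLeastAtMost_iff has_real_derivative_iff_has_vector_derivative less_eq_real_def)
  \<comment> \<open>\<open>\<Phi>'\<close> is the source of the wave equation integrated over a horizontal slice of the
    characteristic triangle below \<open>(s, t)\<close>.\<close>
  define \<Phi> where "\<Phi> = (\<lambda>z. - (f (s + t - z) + f (s - t + z)) * f z
                              - (g (s + t - z) - g (s - t + z)) * f' z)"
  define \<Phi>' where "\<Phi>' = (\<lambda>z. (f' (s + t - z) - f' (s - t + z)) * f z
                              - (g (s + t - z) - g (s - t + z)) * f'' z)"
  have \<Phi>: "(\<Phi> has_real_derivative \<Phi>' z) (at z)" if "0 \<le> z" "z \<le> t" for z
  proof -
    have lin: "((\<lambda>z. s + t - z) has_real_derivative -1) (at z)" "((\<lambda>z. s - t + z) has_real_derivative 1) (at z)"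
      by (auto intro!: derivative_eq_intros)
    have ge: "((\<lambda>z. g (s + t - z)) has_real_derivative f (s + t - z) * -1) (at z)"
      "((\<lambda>z. g (s - t + z)) has_real_derivative f (s - t + z) * 1) (at z)"
      using that st by (intro DERIV_chain2[OF g lin(1)] DERIV_chain2[OF g lin(2)]; simp)+
    note fe = DERIV_chain2[OF f lin(1)] DERIV_chain2[OF f lin(2)]
    show ?thesis
      unfolding \<Phi>_def \<Phi>'_def
      by (rule DERIV_cong, (rule ge fe f f' DERIV_add DERIV_diff DERIV_minus DERIV_mult)+) (simp add: algebra_simps)
  qed
  have "\<theta> * \<Phi>' z \<ge> 0" if z: "0 \<le> z" "z \<le> t" for z
  proof -
    \<comment> \<open>\<open>j\<close> is an antiderivative in \<open>y\<close> of half the source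
      at height \<open>z\<close>, so its monotonicity gives the sign of the slice integral.\<close>
    define j where "j = (\<lambda>y. f' y * f z - g y * f'' z)"
    have "\<exists>d. ((\<lambda>y. \<theta> * j y) has_real_derivative d) (at y) \<and> d \<ge> 0"
      if y: "s - t + z \<le> y" "y \<le> s + t - z" for y
    proof -
      have "((\<lambda>y. \<theta> * j y) has_real_derivative \<theta> * (f'' y * f z - f y * f'' z)) (at y)"
        unfolding j_def using y z st
        by (intro DERIV_cmult DERIV_diff DERIV_cmult_right f' g) auto
      moreover have "\<theta> * (f'' y * f z - f y * f'' z) \<ge> 0"
        using mono[of z y] y z st by simp
      ultimately show ?thesis by blast
    qed
    then have "\<theta> * j (s - t + z) \<le> \<theta> * j (s + t - z)"
      using DERIV_nonneg_imp_nondecreasing[of "s - t + z" "s + t - z" "\<lambda>y. \<theta> * j y"] z by simp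
    moreover have "\<theta> * \<Phi>' z = \<theta> * j (s + t - z) - \<theta> * j (s - t + z)"
      unfolding \<Phi>'_def j_def by (simp add: algebra_simps)
    ultimately show ?thesis by simp
  qed
  then have "\<exists>d. ((\<lambda>z. \<theta> * \<Phi> z) has_real_derivative d) (at z) \<and> d \<ge> 0" if "0 \<le> z" "z \<le> t" for z
    using that DERIV_cmult[OF \<Phi>] by blast
  then have "\<theta> * \<Phi> 0 \<le> \<theta> * \<Phi> t"
    using DERIV_nonneg_imp_nondecreasing[of 0 t "\<lambda>z. \<theta> * \<Phi> z"] st by simp
  \<comment> \<open>In \<open>\<Phi> t\<close> the terms with \<open>g\<close> cancel, and in
    \<open>\<Phi> 0\<close> they carry the factor \<open>f' 0 = 0\<close>; what remains of
    \<open>\<Phi> t - \<Phi> 0\<close> is the claimed expression.\<close>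
  then show ?thesis
    unfolding \<Phi>_def by (simp add: f'0 algebra_simps)
qed

section \<open>Powers of the hyperbolic cosine and the excess function\<close>

definition two_cosh :: "real \<Rightarrow> real" where
  "two_cosh s = exp s + exp (- s)"

text \<open>For \<open>b = 1 / \<alpha>\<close> this is \<open>pair_norm \<alpha>\<close> of the
  pair \<open>exp (b * s)\<close>, \<open>exp (- (b * s))\<close> minus the sum of the pair.\<close>

definition excess :: "real \<Rightarrow> real \<Rightarrow> real" where
  "excess b s = two_cosh s powr b - two_cosh (b * s)"

lemma two_cosh_pos: "two_cosh s > 0"
  by (simp add: two_cosh_def add_pos_pos)

lemma two_cosh_minus [simp]: "two_cosh (- s) = two_cosh s"
  by (simp add: two_cosh_def)

lemma excess_minus [simp]: "excess b (- s) = excess b s"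
  by (simp add: excess_def)

lemma two_cosh_deriv: "(two_cosh has_real_derivative exp s - exp (- s)) (at s)"
  unfolding two_cosh_def by (auto intro!: derivative_eq_intros)

lemma two_cosh_powr_deriv:
  "((\<lambda>s. two_cosh s powr c) has_real_derivative c * two_cosh s powr (c - 1) * (exp s - exp (- s))) (at s)"
  using DERIV_fun_powr[OF two_cosh_deriv two_cosh_pos, of c s] by simp

lemma two_cosh_scale_deriv:
  "((\<lambda>s. two_cosh (b * s)) has_real_derivative b * (exp (b * s) - exp (- (b * s)))) (at s)"
  unfolding two_cosh_def by (auto intro!: derivative_eq_intros simp: algebra_simps)

text \<open>This is \<open>excess\<close> divided by \<open>two_cosh s powr (b - 2)\<close>. The
  second derivative of \<open>excess\<close> is \<open>b\<^sup>2\<close> times \<open>excess\<close>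
  minus \<open>4 * b * (b - 1)\<close> times that power, so the monotonicity of
  \<open>f'' / f\<close> becomes that of \<open>(b - 1) * excess_ratio b\<close>, with no division
  by \<open>excess\<close>, which vanishes for \<open>b = 1\<close>.\<close>

definition excess_ratio :: "real \<Rightarrow> real \<Rightarrow> real" where
  "excess_ratio b s = two_cosh s powr 2 - two_cosh (b * s) * two_cosh s powr (2 - b)"

lemma excess_ratio: "excess b s = two_cosh s powr (b - 2) * excess_ratio b s"
proof -
  have "two_cosh s powr (b - 2) * two_cosh s powr 2 = two_cosh s powr b"
    "two_cosh s powr (b - 2) * two_cosh s powr (2 - b) = 1"
    using two_cosh_pos[of s] by (simp_all only: powr_add[symmetric]) simp_all
  then show ?thesis
    unfolding excess_def excess_ratio_def right_diff_distrib
    by (metis mult.left_commute mult.right_neutral)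
qed

lemma excess_ratio_deriv:
  "(excess_ratio b has_real_derivative
     2 * two_cosh s powr (1 - b) * exp ((b + 1) * s) * slope b (exp (- 2 * s))) (at s)"
proof -
  define x where "x = exp (- 2 * s)"
  define D where "D = two_cosh s powr (1 - b)"
  have "(excess_ratio b has_real_derivative
      2 * two_cosh s powr (2 - 1) * (exp s - exp (- s))
      - (b * (exp (b * s) - exp (- (b * s))) * two_cosh s powr (2 - b)
         + (2 - b) * two_cosh s powr (2 - b - 1) * (exp s - exp (- s)) * two_cosh (b * s))) (at s)"
    unfolding excess_ratio_def by (intro DERIV_diff DERIV_mult two_cosh_powr_deriv two_cosh_scale_deriv)
  moreover have "two_cosh s powr (2 - 1) = D * two_cosh s powr b" "two_cosh s powr (2 - b) = D * two_cosh s"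
    "two_cosh s powr (2 - b - 1) = D"
    using two_cosh_pos[of s] by (simp_all add: D_def powr_add[symmetric] powr_mult_base mult.commute)
  moreover have ex: "exp (- s) = exp s * x" "exp (- (b * s)) = exp (b * s) * x powr b"
    by (simp_all add: x_def powr_def flip: exp_add)
  moreover have "two_cosh s = exp s * (1 + x)"
    "two_cosh (b * s) = exp (b * s) * (1 + x powr b)"
    by (simp_all add: two_cosh_def ex algebra_simps)
  moreover have "(exp s * (1 + x)) powr b = exp (b * s) * (1 + x) powr b"
    by (simp add: powr_mult exp_powr_real x_def mult.commute)
  moreover have "exp ((b + 1) * s) = exp (b * s) * exp s" "x powr (b + 1) = x * x powr b"
    using powr_mult_base[of x b] by (simp_all add: algebra_simps exp_add x_def add.commute)
  ultimately show ?thesis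
    unfolding x_def[symmetric] D_def[symmetric] slope_def by (elim DERIV_cong) (simp add: algebra_simps)
qed

lemma excess_ratio_mono:
  assumes "b > 0" "\<theta> * ((b - 2) * (b - 3)) \<ge> 0" "0 \<le> s" "s \<le> t"
  shows "\<theta> * ((b - 1) * excess_ratio b s) \<le> \<theta> * ((b - 1) * excess_ratio b t)"
proof (rule DERIV_nonneg_imp_nondecreasing[OF assms(4)])
  fix z assume z: "s \<le> z" "z \<le> t"
  have "\<theta> * ((b - 1) * slope b (exp (- 2 * z))) \<ge> 0"
    using assms z by (intro slope_sign) auto
  then have "2 * two_cosh z powr (1 - b) * exp ((b + 1) * z) * (\<theta> * ((b - 1) * slope b (exp (- 2 * z)))) \<ge> 0"
    by (rule mult_nonneg_nonneg[rotated]) simp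
  then have "\<theta> * ((b - 1) * (2 * two_cosh z powr (1 - b) * exp ((b + 1) * z) * slope b (exp (- 2 * z)))) \<ge> 0"
    by (simp only: mult_ac)
  then show "\<exists>d. ((\<lambda>s. \<theta> * ((b - 1) * excess_ratio b s)) has_real_derivative d) (at z) \<and> d \<ge> 0"
    using DERIV_cmult[OF DERIV_cmult[OF excess_ratio_deriv]] by blast
qed

lemma excess_addition_inequality:
  assumes b: "b > 0" and \<theta>: "\<theta> * ((b - 2) * (b - 3)) \<ge> 0"
  shows "\<theta> * (excess b 0 * (excess b (s + t) + excess b (s - t)) - 2 * excess b s * excess b t) \<ge> 0"
proof -
  define f' where "f' = (\<lambda>s. b * two_cosh s powr (b - 1) * (exp s - exp (- s)) - b * (exp (b * s) - exp (- (b * s))))"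
  define f'' where "f'' = (\<lambda>s. b\<^sup>2 * excess b s - 4 * b * (b - 1) * two_cosh s powr (b - 2))"
  have f: "(excess b has_real_derivative f' s) (at s)" for s
    unfolding excess_def f'_def by (intro DERIV_diff two_cosh_powr_deriv two_cosh_scale_deriv)
  have f': "(f' has_real_derivative f'' s) (at s)" for s
  proof -
    have sinh: "((\<lambda>s. exp (c * s) - exp (- (c * s))) has_real_derivative c * two_cosh (c * s)) (at s)" for c
      unfolding two_cosh_def by (auto intro!: derivative_eq_intros simp: algebra_simps)
    have p: "two_cosh s powr (b - 1) = two_cosh s * two_cosh s powr (b - 2)"
      "two_cosh s powr b = two_cosh s * (two_cosh s * two_cosh s powr (b - 2))"
      using two_cosh_pos[of s] powr_mult_base[of "two_cosh s" "b - 2"] powr_mult_base[of "two_cosh s" "b - 1"] by simp_all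
    have sq: "(exp s - exp (- s)) * (exp s - exp (- s)) = two_cosh s * two_cosh s - 4"
      by (simp add: two_cosh_def algebra_simps flip: exp_add)
    have "(f' has_real_derivative
       (b * ((b - 1) * two_cosh s powr (b - 1 - 1) * (exp s - exp (- s)))) * (exp s - exp (- s))
       + two_cosh s * (b * two_cosh s powr (b - 1)) - b * (b * two_cosh (b * s))) (at s)"
      unfolding f'_def using sinh[of 1] by (intro DERIV_diff DERIV_mult DERIV_cmult two_cosh_powr_deriv sinh) simp
    also have "(b * ((b - 1) * two_cosh s powr (b - 1 - 1) * (exp s - exp (- s)))) * (exp s - exp (- s))
       + two_cosh s * (b * two_cosh s powr (b - 1)) - b * (b * two_cosh (b * s))
      = b * (b - 1) * two_cosh s powr (b - 2) * ((exp s - exp (- s)) * (exp s - exp (- s)))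
       + two_cosh s * (b * two_cosh s powr (b - 1)) - b * (b * two_cosh (b * s))"
      by simp
    also have "... = f'' s"
      unfolding sq f''_def excess_def p by (simp add: power2_eq_square algebra_simps)
    finally show ?thesis .
  qed
  have mono: "\<theta> * (f'' y * excess b x - excess b y * f'' x) \<ge> 0" if "0 \<le> x" "x \<le> y" for x y
  proof -
    \<comment> \<open>The multiples of \<open>b\<^sup>2\<close> cancel in this Wronskian-like
      expression, which leaves a difference of two values of \<open>excess_ratio\<close>.\<close>
    have "f'' y * excess b x - excess b y * f'' x = 4 * b * (b - 1)
        * (excess b y * two_cosh x powr (b - 2) - two_cosh y powr (b - 2) * excess b x)"
      unfolding f''_def by (simp add: algebra_simps)
    also have "... = 4 * b * (two_cosh x powr (b - 2) * two_cosh y powr (b - 2))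
        * ((b - 1) * excess_ratio b y - (b - 1) * excess_ratio b x)"
      unfolding excess_ratio by (simp add: algebra_simps)
    finally have "\<theta> * (f'' y * excess b x - excess b y * f'' x) =
        4 * b * (two_cosh x powr (b - 2) * two_cosh y powr (b - 2))
        * (\<theta> * ((b - 1) * excess_ratio b y) - \<theta> * ((b - 1) * excess_ratio b x))"
      by (simp only: right_diff_distrib mult_ac)
    then show ?thesis
      using excess_ratio_mono[OF b \<theta> that] b by simp
  qed
  have ordered: "\<theta> * (excess b 0 * (excess b (s + t) + excess b (s - t)) - 2 * excess b s * excess b t) \<ge> 0"
    if "0 \<le> t" "t \<le> s" for s t
    by (rule addition_inequality_if_log_derivative_mono[OF f f' _ mono that]) (simp_all add: f'_def)
  \<comment> \<open>As \<open>excess\<close> is even, the expression is invariant under exchanging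
    \<open>s\<close> and \<open>t\<close> and under changing the sign of either, so the ordered case
    suffices.\<close>
  have nonneg: "\<theta> * (excess b 0 * (excess b (s + t) + excess b (s - t)) - 2 * excess b s * excess b t) \<ge> 0"
    if "0 \<le> t" "0 \<le> s" for s t
    using ordered[of t s] ordered[of s t] that excess_minus[of b "s - t"]
    by (cases "t \<le> s") (auto simp: algebra_simps)
  have "excess b (\<bar>s\<bar> + \<bar>t\<bar>) + excess b (\<bar>s\<bar> - \<bar>t\<bar>) = excess b (s + t) + excess b (s - t)"
    using excess_minus[of b "s - t"] excess_minus[of b "s + t"] by (auto simp: abs_if algebra_simps)
  moreover have "excess b \<bar>s\<bar> = excess b s" "excess b \<bar>t\<bar> = excess b t"
    by (auto simp: abs_if)
  ultimately show ?thesis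
    using nonneg[of "\<bar>t\<bar>" "\<bar>s\<bar>"] by simp
qed

subsection \<open>Norms of pairs\<close>

text \<open>This is the l^\<alpha> norm of a vector with two nonnegative entries, only a quasi-norm
  for \<open>\<alpha> < 1\<close>. Its homogeneity allows joint probabilities in place of
  conditional ones.\<close>

definition pair_norm :: "real \<Rightarrow> real \<Rightarrow> real \<Rightarrow> real" where
  "pair_norm \<alpha> a0 a1 = (a0 powr \<alpha> + a1 powr \<alpha>) powr (1 / \<alpha>)"

lemma pair_norm_commute: "pair_norm \<alpha> a0 a1 = pair_norm \<alpha> a1 a0"
  by (simp add: pair_norm_def add.commute)

lemma pair_norm_0 [simp]:
  assumes "\<alpha> > 0" "a \<ge> 0"
  shows "pair_norm \<alpha> 0 a = a" "pair_norm \<alpha> a 0 = a"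
  using assms by (simp_all add: pair_norm_def powr_powr)

lemma pair_norm_scale:
  assumes "\<alpha> > 0" "c \<ge> 0" "a0 \<ge> 0" "a1 \<ge> 0"
  shows "pair_norm \<alpha> (c * a0) (c * a1) = c * pair_norm \<alpha> a0 a1"
  using assms by (simp add: pair_norm_def powr_mult powr_powr flip: distrib_left)

lemma pair_norm_diagonal:
  assumes "\<alpha> > 0" "a \<ge> 0"
  shows "pair_norm \<alpha> a a = 2 * a * 2 powr (1 / \<alpha> - 1)"
proof -
  have "pair_norm \<alpha> a a = 2 powr (1 / \<alpha>) * a"
    using assms by (simp add: pair_norm_def powr_mult powr_powr flip: mult_2)
  also have "2 powr (1 / \<alpha>) = (2::real) * 2 powr (1 / \<alpha> - 1)"
    by (simp add: powr_mult_base)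
  finally show ?thesis by simp
qed

lemma pair_norm_exp: "pair_norm \<alpha> (exp (s / \<alpha>)) (exp (- s / \<alpha>)) = two_cosh s powr (1 / \<alpha>)" if "\<alpha> > 0"
  using that by (simp add: pair_norm_def two_cosh_def exp_powr_real)

lemma pair_exp_coordinates:
  assumes "\<alpha> > 0" "a0 > 0" "a1 > (0::real)"
  obtains c s where "c > 0" "a0 = c * exp (s / \<alpha>)" "a1 = c * exp (- s / \<alpha>)"
proof
  \<comment> \<open>\<open>c\<close> is the geometric mean of the entries, and
    \<open>s / \<alpha>\<close> is half the logarithm of their ratio.\<close>
  define c where "c = exp ((ln a0 + ln a1) / 2)"
  define s where "s = \<alpha> * ((ln a0 - ln a1) / 2)"
  show "c > 0" by (simp add: c_def)
  have "c * exp (s / \<alpha>) = exp (ln a0)"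
    using assms(1) by (simp add: c_def s_def field_simps flip: exp_add)
  then show "a0 = c * exp (s / \<alpha>)" using assms by simp
  have "c * exp (- s / \<alpha>) = exp (ln a1)"
    using assms(1) by (simp add: c_def s_def field_simps flip: exp_add)
  then show "a1 = c * exp (- s / \<alpha>)" using assms by simp
qed

text \<open>This is subadditivity of the power: as \<open>\<alpha> - 1\<close> is nonpositive, each
  entry \<open>a\<close> satisfies
  \<open>a * (a0 + a1) powr (\<alpha> - 1) \<le> a powr \<alpha>\<close>, and the two bounds are
  added.\<close>

lemma pair_norm_ge_sum:
  assumes "0 < \<alpha>" "\<alpha> \<le> 1" "a0 \<ge> 0" "a1 \<ge> 0"
  shows "pair_norm \<alpha> a0 a1 \<ge> a0 + a1"
proof -
  have *: "a * (a0 + a1) powr (\<alpha> - 1) \<le> a powr \<alpha>" if "0 \<le> a" "a \<le> a0 + a1" for a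
  proof (cases "a = 0")
    case False
    then have "(a0 + a1) powr (\<alpha> - 1) \<le> a powr (\<alpha> - 1)"
      using assms that by (intro powr_mono2') auto
    then have "a * (a0 + a1) powr (\<alpha> - 1) \<le> a * a powr (\<alpha> - 1)"
      using that by (intro mult_left_mono)
    then show ?thesis using that by (simp add: powr_mult_base)
  qed simp
  have "(a0 + a1) powr \<alpha> = (a0 + a1) * (a0 + a1) powr (\<alpha> - 1)"
    using assms by (simp add: powr_mult_base)
  then have "(a0 + a1) powr \<alpha> \<le> a0 powr \<alpha> + a1 powr \<alpha>"
    using *[of a0] *[of a1] assms by (simp add: algebra_simps)
  then have "((a0 + a1) powr \<alpha>) powr (1 / \<alpha>) \<le> pair_norm \<alpha> a0 a1"
    unfolding pair_norm_def using assms by (intro powr_mono2) auto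
  then show ?thesis using assms by (simp add: powr_powr)
qed

lemma pair_norm_le_sum:
  assumes "1 \<le> \<alpha>" "a0 \<ge> 0" "a1 \<ge> 0"
  shows "pair_norm \<alpha> a0 a1 \<le> a0 + a1"
proof -
  have *: "a powr \<alpha> \<le> a * (a0 + a1) powr (\<alpha> - 1)" if "0 \<le> a" "a \<le> a0 + a1" for a
  proof -
    have "a powr (\<alpha> - 1) \<le> (a0 + a1) powr (\<alpha> - 1)"
      using assms that by (intro powr_mono2) auto
    then have "a * a powr (\<alpha> - 1) \<le> a * (a0 + a1) powr (\<alpha> - 1)"
      using that by (intro mult_left_mono)
    then show ?thesis using that by (simp add: powr_mult_base)
  qed
  have "(a0 + a1) powr \<alpha> = (a0 + a1) * (a0 + a1) powr (\<alpha> - 1)"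
    using assms by (simp add: powr_mult_base)
  then have "a0 powr \<alpha> + a1 powr \<alpha> \<le> (a0 + a1) powr \<alpha>"
    using *[of a0] *[of a1] assms by (simp add: algebra_simps)
  then have "pair_norm \<alpha> a0 a1 \<le> ((a0 + a1) powr \<alpha>) powr (1 / \<alpha>)"
    unfolding pair_norm_def using assms by (intro powr_mono2) auto
  then show ?thesis using assms by (simp add: powr_powr)
qed

text \<open>By convexity of the power at the midpoint, the norm for a given sum is least when the
  entries agree. A zero entry is treated directly, since there the norm is the other entry.\<close>

lemma pair_norm_ge_scaled_sum:
  assumes "1 \<le> \<alpha>" "a0 \<ge> 0" "a1 \<ge> 0"
  shows "pair_norm \<alpha> a0 a1 \<ge> 2 powr (1 / \<alpha> - 1) * (a0 + a1)"
proof (cases "a0 = 0 \<or> a1 = 0")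
  case True
  have "2 powr (1 / \<alpha> - 1) \<le> (2::real) powr 0"
    using assms by (intro powr_mono) auto
  then show ?thesis
    using True assms mult_right_mono[of "2 powr (1 / \<alpha> - 1)" 1 a0] mult_right_mono[of "2 powr (1 / \<alpha> - 1)" 1 a1]
    by auto
next
  case False
  then have pos: "a0 > 0" "a1 > 0"
    using assms by auto
  have "((a0 + a1) / 2) powr \<alpha> \<le> (a0 powr \<alpha> + a1 powr \<alpha>) / 2"
    using convex_onD[OF powr_convex[OF assms(1)], of "1/2" a0 a1] pos by (simp add: field_simps)
  then have "pair_norm \<alpha> ((a0 + a1) / 2) ((a0 + a1) / 2) \<le> pair_norm \<alpha> a0 a1"
    unfolding pair_norm_def using assms by (intro powr_mono2) auto
  then show ?thesis
    using pair_norm_diagonal[of \<alpha> "(a0 + a1) / 2"] assms by (simp add: algebra_simps)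
qed

text \<open>This is the contribution of one pair of outputs to
  \<open>(D - 1) * (S12 - 1) - (S1 - 1) * (S2 - 1)\<close>, each 1 being expanded into a total mass.
  The first two norms belong to the values 0 and 1 of the sum of the inputs.\<close>

definition gap :: "real \<Rightarrow> real \<Rightarrow> real \<Rightarrow> real \<Rightarrow> real \<Rightarrow> real" where
  "gap \<alpha> a0 a1 b0 b1 =
     (2 powr (1 / \<alpha> - 1) - 1)
       * (pair_norm \<alpha> (a0 * b0) (a1 * b1) + pair_norm \<alpha> (a1 * b0) (a0 * b1) - (a0 + a1) * (b0 + b1))
     - (pair_norm \<alpha> a0 a1 - (a0 + a1)) * (pair_norm \<alpha> b0 b1 - (b0 + b1))"

text \<open>These are the pairs of masses that an output of an erasure channel can have. With a zero
  entry both terms of \<open>gap\<close> vanish; with equal entries both are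
  \<open>2 * a0 * (D - 1)\<close> times the excess of the norm of the other pair over its sum. Both
  orders are given because in \<open>gap_sign\<close> the zero may occur in either pair.\<close>

lemma gap_eq_0:
  assumes "\<alpha> > 0" "a0 \<ge> 0" "a1 \<ge> 0" "b0 \<ge> 0" "b1 \<ge> 0" "a0 = 0 \<or> a1 = 0 \<or> a0 = a1"
  shows "gap \<alpha> a0 a1 b0 b1 = 0" "gap \<alpha> b0 b1 a0 a1 = 0"
proof -
  have "gap \<alpha> a0 a1 b0 b1 = 0 \<and> gap \<alpha> b0 b1 a0 a1 = 0"
    using assms(6)
  proof (elim disjE)
    assume "a0 = a1"
    then show ?thesis
      using assms pair_norm_commute[of \<alpha> b1 b0]
      by (simp add: gap_def pair_norm_scale pair_norm_diagonal mult.commute[of _ a1] algebra_simps)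
  qed (use assms in \<open>simp_all add: gap_def algebra_simps\<close>)
  then show "gap \<alpha> a0 a1 b0 b1 = 0" "gap \<alpha> b0 b1 a0 a1 = 0" by auto
qed

text \<open>Zero entries give equality. For positive entries the exponential coordinates turn the
  four products into the parameters \<open>s + t\<close> and \<open>s - t\<close>, and
  \<open>gap\<close> into a positive multiple of the expression in
  \<open>excess_addition_inequality\<close>.\<close>

lemma gap_sign:
  assumes \<alpha>: "\<alpha> > 0" and \<theta>: "\<theta> * ((1 / \<alpha> - 2) * (1 / \<alpha> - 3)) \<ge> 0"
    and nonneg: "a0 \<ge> 0" "a1 \<ge> 0" "b0 \<ge> 0" "b1 \<ge> 0"
  shows "\<theta> * gap \<alpha> a0 a1 b0 b1 \<ge> 0"
proof (cases "a0 = 0 \<or> a1 = 0 \<or> b0 = 0 \<or> b1 = 0")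
  case True
  then show ?thesis
    using gap_eq_0[OF \<alpha> nonneg] gap_eq_0(2)[OF \<alpha> nonneg(3,4,1,2)] by auto
next
  case False
  define \<beta> where "\<beta> = 1 / \<alpha>"
  have \<beta>: "\<beta> > 0" using \<alpha> by (simp add: \<beta>_def)
  have pos: "a0 > 0" "a1 > 0" "b0 > 0" "b1 > 0"
    using False nonneg by auto
  obtain c s where cs: "c > 0" "a0 = c * exp (s / \<alpha>)" "a1 = c * exp (- s / \<alpha>)"
    using pair_exp_coordinates[OF \<alpha> pos(1,2)] .
  obtain d t where dt: "d > 0" "b0 = d * exp (t / \<alpha>)" "b1 = d * exp (- t / \<alpha>)"
    using pair_exp_coordinates[OF \<alpha> pos(3,4)] .
  have norm: "pair_norm \<alpha> (e * exp (r / \<alpha>)) (e * exp (- r / \<alpha>)) = e * two_cosh r powr \<beta>" if "e > 0" for e r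
    using that \<alpha> by (simp add: pair_norm_scale pair_norm_exp[OF \<alpha>, simplified] \<beta>_def)
  have sum: "e * exp (r / \<alpha>) + e * exp (- r / \<alpha>) = e * two_cosh (\<beta> * r)" for e r
    by (simp add: two_cosh_def \<beta>_def algebra_simps)
  have prods: "a0 * b0 = (c * d) * exp ((s + t) / \<alpha>)" "a1 * b1 = (c * d) * exp (- (s + t) / \<alpha>)"
    "a0 * b1 = (c * d) * exp ((s - t) / \<alpha>)" "a1 * b0 = (c * d) * exp (- (s - t) / \<alpha>)"
    unfolding cs dt by (simp_all add: add_divide_distrib diff_divide_distrib mult_ac flip: exp_add)
  have "(a0 + a1) * (b0 + b1) = (a0 * b0 + a1 * b1) + (a0 * b1 + a1 * b0)"
    by (simp add: algebra_simps)
  then have sums: "(a0 + a1) * (b0 + b1) = (c * d) * two_cosh (\<beta> * (s + t)) + (c * d) * two_cosh (\<beta> * (s - t))"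
    unfolding prods sum .
  have cd: "c * d > 0" using cs dt by simp
  have norms: "pair_norm \<alpha> (a0 * b0) (a1 * b1) = (c * d) * two_cosh (s + t) powr \<beta>"
    "pair_norm \<alpha> (a1 * b0) (a0 * b1) = (c * d) * two_cosh (s - t) powr \<beta>"
    unfolding prods pair_norm_commute[of \<alpha> "c * d * exp (- (s - t) / \<alpha>)"] by (rule norm[OF cd])+
  have "excess \<beta> 0 = 2 * (2 powr (1 / \<alpha> - 1) - 1)"
    using powr_mult_base[of 2 "\<beta> - 1"] by (simp add: excess_def two_cosh_def \<beta>_def)
  then have delta: "2 powr (1 / \<alpha> - 1) - 1 = excess \<beta> 0 / 2" by simp
  have diffs: "pair_norm \<alpha> a0 a1 - (a0 + a1) = c * excess \<beta> s" "pair_norm \<alpha> b0 b1 - (b0 + b1) = d * excess \<beta> t"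
    unfolding cs dt sum norm[OF cs(1)] norm[OF dt(1)] excess_def by (simp_all add: algebra_simps)
  have "gap \<alpha> a0 a1 b0 b1 = excess \<beta> 0 / 2 * ((c * d) * excess \<beta> (s + t) + (c * d) * excess \<beta> (s - t))
      - c * excess \<beta> s * (d * excess \<beta> t)"
    unfolding gap_def norms sums delta diffs unfolding excess_def by (simp add: algebra_simps)
  also have "\<dots> = (c * d / 2)
      * (excess \<beta> 0 * (excess \<beta> (s + t) + excess \<beta> (s - t)) - 2 * excess \<beta> s * excess \<beta> t)"
    by (simp add: algebra_simps)
  finally have eq: "\<theta> * gap \<alpha> a0 a1 b0 b1 = (c * d / 2)
      * (\<theta> * (excess \<beta> 0 * (excess \<beta> (s + t) + excess \<beta> (s - t)) - 2 * excess \<beta> s * excess \<beta> t))"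
    by (simp only: mult.left_commute)
  have "\<theta> * ((\<beta> - 2) * (\<beta> - 3)) \<ge> 0"
    using \<theta> by (simp only: \<beta>_def)
  from excess_addition_inequality[OF \<beta> this, of s t] show ?thesis
    unfolding eq by (rule mult_nonneg_nonneg[rotated]) (use cd in simp)
qed

subsection \<open>Entropies\<close>

lemma UNIV_bit: "(UNIV :: bit set) = {0, 1}"
  using bit_not_zero_iff by auto

definition total_norm :: "real \<Rightarrow> (bit \<times> 'y::finite) pmf \<Rightarrow> real" where
  "total_norm \<alpha> p = (\<Sum>y\<in>UNIV. pair_norm \<alpha> (pmf p (0, y)) (pmf p (1, y)))"

lemma pmf_map_snd_bit:
  fixes p :: "(bit \<times> 'y) pmf"
  shows "pmf (map_pmf snd p) y = pmf p (0, y) + pmf p (1, y)"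
proof -
  have eq: "snd -` {y} = {(0 :: bit, y), (1, y)}"
    using bit_not_zero_iff by auto
  show ?thesis
    unfolding pmf_map eq by (subst measure_measure_pmf_finite) auto
qed

lemma sum_pmf_bit:
  fixes p :: "(bit \<times> 'y::finite) pmf"
  shows "(\<Sum>y\<in>UNIV. pmf p (0, y) + pmf p (1, y)) = 1"
  unfolding pmf_map_snd_bit[symmetric] by (rule sum_pmf_eq_1) auto

text \<open>Homogeneity moves the probability of the output into the norm, and outputs outside the
  support contribute zero.\<close>

lemma arimoto_formula_eq:
  fixes p :: "(bit \<times> 'y::finite) pmf"
  assumes \<alpha>: "\<alpha> > 0"
  shows "arimoto_formula p \<alpha> = \<alpha> / (1 - \<alpha>) * ln (total_norm \<alpha> p)"
proof -
  let ?P = "pmf (map_pmf snd p)"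
  have "?P y * (\<Sum>x\<in>UNIV. cond_prob p x y powr \<alpha>) powr (1 / \<alpha>) = pair_norm \<alpha> (pmf p (0, y)) (pmf p (1, y))"
    if "y \<in> set_pmf (map_pmf snd p)" for y
  proof -
    have P: "?P y > 0"
      using that by (simp only: pmf_positive_iff)
    have joint: "?P y * cond_prob p x y = pmf p (x, y)" for x
      using P by (simp add: cond_prob_def)
    have "?P y * pair_norm \<alpha> (cond_prob p 0 y) (cond_prob p 1 y)
        = pair_norm \<alpha> (?P y * cond_prob p 0 y) (?P y * cond_prob p 1 y)"
      using \<alpha> by (intro pair_norm_scale[symmetric]) (auto simp: cond_prob_nonneg)
    then show ?thesis
      unfolding joint by (simp add: pair_norm_def UNIV_bit)
  qed
  then have "(\<Sum>y\<in>set_pmf (map_pmf snd p). ?P y * (\<Sum>x\<in>UNIV. cond_prob p x y powr \<alpha>) powr (1 / \<alpha>))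
      = (\<Sum>y\<in>set_pmf (map_pmf snd p). pair_norm \<alpha> (pmf p (0, y)) (pmf p (1, y)))"
    by (intro sum.cong) auto
  also have "\<dots> = total_norm \<alpha> p"
    unfolding total_norm_def
  proof (rule sum.mono_neutral_left)
    show "\<forall>y\<in>UNIV - set_pmf (map_pmf snd p). pair_norm \<alpha> (pmf p (0, y)) (pmf p (1, y)) = 0"
    proof
      fix y assume "y \<in> UNIV - set_pmf (map_pmf snd p)"
      then have "?P y = 0"
        by (simp only: set_pmf_iff Diff_iff) simp
      then have "pmf p (0, y) = 0" "pmf p (1, y) = 0"
        unfolding pmf_map_snd_bit by (simp_all add: add_nonneg_eq_0_iff)
      then show "pair_norm \<alpha> (pmf p (0, y)) (pmf p (1, y)) = 0"
        using \<alpha> by simp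
    qed
  qed auto
  finally show ?thesis
    unfolding arimoto_formula_def by simp
qed

section \<open>Bounds on the sum of norms\<close>

lemma total_norm_ge_1:
  assumes "0 < \<alpha>" "\<alpha> \<le> 1"
  shows "total_norm \<alpha> p \<ge> 1"
  unfolding total_norm_def sum_pmf_bit[of p, symmetric]
  using assms by (intro sum_mono pair_norm_ge_sum) auto

lemma total_norm_le_1:
  assumes "1 \<le> \<alpha>"
  shows "total_norm \<alpha> p \<le> 1"
  unfolding total_norm_def sum_pmf_bit[of p, symmetric]
  using assms by (intro sum_mono pair_norm_le_sum) auto

lemma total_norm_ge_scale:
  assumes "1 \<le> \<alpha>"
  shows "total_norm \<alpha> p \<ge> 2 powr (1 / \<alpha> - 1)"
proof -
  have "2 powr (1 / \<alpha> - 1) * (\<Sum>y\<in>UNIV. pmf p (0, y) + pmf p (1, y)) \<le> total_norm \<alpha> p"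
    unfolding total_norm_def sum_distrib_left
    using assms by (intro sum_mono pair_norm_ge_scaled_sum) auto
  then show ?thesis
    by (simp add: sum_pmf_bit)
qed

lemma total_norm_pos: "total_norm \<alpha> p > 0" if "\<alpha> > 0"
proof (cases "\<alpha> \<le> 1")
  case True
  then show ?thesis using total_norm_ge_1[of \<alpha> p] that by simp
next
  case False
  then show ?thesis
    using total_norm_ge_scale[of \<alpha> p] by (smt (verit) powr_gt_zero)
qed

text \<open>The first input is recovered as \<open>z + x\<close>, since subtraction is addition in
  \<open>bit\<close>.\<close>

lemma pmf_sum_given:
  "pmf (sum_given_pmf p1 p2) (x, (z, y1, y2)) = pmf p1 (z + x, y1) * pmf p2 (x, y2)"
proof -
  let ?f = "\<lambda>((x1 :: bit, y1 :: 'a), (x2 :: bit, y2 :: 'b)). (x2, (x1 + x2, y1, y2))"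
  have "inj ?f"
    by (auto simp: inj_on_def)
  moreover have "(x, (z, y1, y2)) = ?f ((z + x, y1), (x, y2))"
    by (cases x) auto
  ultimately show ?thesis
    unfolding sum_given_pmf_def by (simp only: pmf_map_inj' pmf_pair)
qed

text \<open>Writing each 1 as a total probability turns the comparison of the three norm sums into a
  sum over pairs of outputs.\<close>

lemma total_norm_gap:
  fixes p1 :: "(bit \<times> 'y1::finite) pmf" and p2 :: "(bit \<times> 'y2::finite) pmf"
  shows "(2 powr (1 / \<alpha> - 1) - 1) * (total_norm \<alpha> (sum_given_pmf p1 p2) - 1)
      - (total_norm \<alpha> p1 - 1) * (total_norm \<alpha> p2 - 1)
    = (\<Sum>y1\<in>UNIV. \<Sum>y2\<in>UNIV. gap \<alpha> (pmf p1 (0, y1)) (pmf p1 (1, y1)) (pmf p2 (0, y2)) (pmf p2 (1, y2)))"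
proof -
  let ?a0 = "\<lambda>y. pmf p1 (0, y)" and ?a1 = "\<lambda>y. pmf p1 (1, y)"
  let ?b0 = "\<lambda>y. pmf p2 (0, y)" and ?b1 = "\<lambda>y. pmf p2 (1, y)"
  have "total_norm \<alpha> (sum_given_pmf p1 p2) = (\<Sum>z\<in>UNIV. \<Sum>y1\<in>UNIV. \<Sum>y2\<in>UNIV.
      pair_norm \<alpha> (pmf p1 (z, y1) * pmf p2 (0, y2)) (pmf p1 (z + 1, y1) * pmf p2 (1, y2)))"
    unfolding total_norm_def UNIV_Times_UNIV[symmetric] sum.cartesian_product' pmf_sum_given
    by (simp only: add_0_right)
  also have "\<dots> = (\<Sum>y1\<in>UNIV. \<Sum>y2\<in>UNIV. pair_norm \<alpha> (?a0 y1 * ?b0 y2) (?a1 y1 * ?b1 y2)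
      + pair_norm \<alpha> (?a1 y1 * ?b0 y2) (?a0 y1 * ?b1 y2))"
    by (simp add: UNIV_bit sum.distrib)
  finally have S: "total_norm \<alpha> (sum_given_pmf p1 p2) = \<dots>" .
  have one: "1 = (\<Sum>y1\<in>UNIV. \<Sum>y2\<in>UNIV. (?a0 y1 + ?a1 y1) * (?b0 y2 + ?b1 y2))"
    unfolding sum_product[symmetric] sum_pmf_bit by simp
  have diff: "total_norm \<alpha> p - 1 = (\<Sum>y\<in>UNIV. pair_norm \<alpha> (pmf p (0, y)) (pmf p (1, y)) - (pmf p (0, y) + pmf p (1, y)))"
    for p :: "(bit \<times> 'y::finite) pmf"
    by (simp add: total_norm_def sum_subtractf sum_pmf_bit)
  have "total_norm \<alpha> (sum_given_pmf p1 p2) - 1 = (\<Sum>y1\<in>UNIV. \<Sum>y2\<in>UNIV.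
      pair_norm \<alpha> (?a0 y1 * ?b0 y2) (?a1 y1 * ?b1 y2) + pair_norm \<alpha> (?a1 y1 * ?b0 y2) (?a0 y1 * ?b1 y2)
      - (?a0 y1 + ?a1 y1) * (?b0 y2 + ?b1 y2))"
    unfolding S by (subst one) (simp add: sum_subtractf)
  then show ?thesis
    unfolding diff[of p1] diff[of p2] sum_product gap_def
    by (simp only: sum_subtractf[symmetric] sum_distrib_left)
qed

section \<open>From norms back to entropies\<close>

lemma ln_diff_sign:
  fixes x y :: real
  assumes "x > 0" "y > 0" "\<theta> * (x - y) \<ge> 0"
  shows "\<theta> * (ln x - ln y) \<ge> 0"
  using assms by (auto simp: zero_le_mult_iff)

text \<open>The difference of the two sides is
  \<open>\<alpha> / (1 - \<alpha>) * (ln S - ln R)\<close>. The gaps determine the sign of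
  \<open>(D - 1) * (S - R)\<close>, and \<open>D - 1\<close> has the sign of
  \<open>1 - \<alpha>\<close>.\<close>

lemma entropy_gap_sign:
  fixes p1 :: "(bit \<times> 'y1::finite) pmf" and p2 :: "(bit \<times> 'y2::finite) pmf"
  assumes \<alpha>: "\<alpha> > 0" "\<alpha> \<noteq> 1"
    and gap: "\<theta> * (\<Sum>y1\<in>UNIV. \<Sum>y2\<in>UNIV.
      gap \<alpha> (pmf p1 (0, y1)) (pmf p1 (1, y1)) (pmf p2 (0, y2)) (pmf p2 (1, y2))) \<ge> 0"
  shows "\<theta> * (arimoto_formula (sum_given_pmf p1 p2) \<alpha>
      - (arimoto_formula p1 \<alpha> + arimoto_formula p2 \<alpha> - correction_formula p1 p2 \<alpha>)) \<ge> 0"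
proof -
  define D where "D = 2 powr (1 / \<alpha> - 1)"
  define S1 where "S1 = total_norm \<alpha> p1"
  define S2 where "S2 = total_norm \<alpha> p2"
  define S where "S = total_norm \<alpha> (sum_given_pmf p1 p2)"
  \<comment> \<open>\<open>R\<close> is the value of \<open>S\<close> at which the gaps sum to zero.
    \<open>B\<close> is the argument of the logarithm in the correction, where
    \<open>arimoto_delta \<alpha>\<close> is \<open>1 / D\<close> and \<open>arimoto_K\<close> is
    \<open>1 / S1\<close> and \<open>1 / S2\<close>.\<close>
  define R where "R = 1 + (S1 - 1) * (S2 - 1) / (D - 1)"
  define B where "B = (1 / D - 1 / S1) * (1 / D - 1 / S2) / (1 - 1 / D) + 1 / D"
  have pos: "D > 0" "S1 > 0" "S2 > 0" "S > 0"
    using \<alpha> by (simp_all add: D_def S1_def S2_def S_def total_norm_pos)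
  have D1: "D > 1 \<longleftrightarrow> \<alpha> < 1" "D < 1 \<longleftrightarrow> \<alpha> > 1" "D \<noteq> 1"
    using \<alpha> unfolding D_def powr_def by (auto simp: zero_less_mult_iff mult_less_0_iff field_simps)
  have B: "S1 * S2 * B = R"
    using pos D1(3) unfolding B_def R_def by (simp add: field_simps)
  \<comment> \<open>For \<open>\<alpha> > 1\<close>, the bounds \<open>S1 \<ge> D\<close> and
    \<open>0 < S2 \<le> 1\<close> keep \<open>(1 - S1) * (1 - S2)\<close> below
    \<open>1 - D\<close>.\<close>
  have R: "R > 0"
  proof (cases "\<alpha> < 1")
    case True
    then have "S1 \<ge> 1" "S2 \<ge> 1"
      using \<alpha> by (simp_all add: S1_def S2_def total_norm_ge_1)
    then show ?thesis
      using True D1(1) unfolding R_def by (intro add_pos_nonneg) auto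
  next
    case False
    then have "D < 1" using \<alpha> D1 by simp
    have "(1 - S1) * (1 - S2) \<le> (1 - D) * (1 - S2)" "(1 - D) * (1 - S2) < (1 - D) * 1"
      using False \<alpha> pos \<open>D < 1\<close> total_norm_le_1[of \<alpha> p2] total_norm_ge_scale[of \<alpha> p1]
      by (auto simp: S1_def S2_def D_def intro!: mult_right_mono)
    then have "(S1 - 1) * (S2 - 1) < 1 - D"
      by (simp add: algebra_simps)
    then show ?thesis
      using \<open>D < 1\<close> unfolding R_def by (simp add: field_simps)
  qed
  have Bpos: "B > 0"
    using B R pos by (metis mult_pos_pos zero_less_mult_pos)
  have lnR: "ln R = ln S1 + ln S2 + ln B"
    unfolding B[symmetric] using pos Bpos by (simp add: ln_mult)
  have delta: "arimoto_delta \<alpha> = 1 / D"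
  proof -
    have "(\<alpha> - 1) / \<alpha> = - (1 / \<alpha> - 1)" using \<alpha> by (simp add: field_simps)
    then show ?thesis unfolding arimoto_delta_def D_def by (simp only: powr_minus_divide)
  qed
  have K: "arimoto_K \<alpha> p = 1 / total_norm \<alpha> p" for p :: "(bit \<times> 'y::finite) pmf"
  proof -
    have "(\<alpha> - 1) / \<alpha> * (\<alpha> / (1 - \<alpha>) * ln (total_norm \<alpha> p)) = - ln (total_norm \<alpha> p)"
      using \<alpha> by (simp add: divide_simps) (simp add: algebra_simps)
    then show ?thesis
      using \<alpha> total_norm_pos[of \<alpha> p]
      by (simp only: arimoto_K_def arimoto_entropy_def if_False arimoto_formula_eq) (simp add: exp_minus inverse_eq_divide)
  qed
  have corr: "correction_formula p1 p2 \<alpha> = - (\<alpha> / (1 - \<alpha>) * ln B)"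
    unfolding correction_formula_def delta K B_def S1_def S2_def
    by (metis minus_diff_eq minus_divide_right minus_mult_left)
  have E: "arimoto_formula (sum_given_pmf p1 p2) \<alpha>
      - (arimoto_formula p1 \<alpha> + arimoto_formula p2 \<alpha> - correction_formula p1 p2 \<alpha>)
      = \<alpha> / (1 - \<alpha>) * (ln S - ln R)"
    unfolding corr arimoto_formula_eq[OF \<alpha>(1)] lnR S_def S1_def S2_def by (simp only: algebra_simps)
  have "(D - 1) * (S - R) = (D - 1) * (S - 1) - (S1 - 1) * (S2 - 1)"
    unfolding R_def using D1(3) by (simp add: field_simps)
  then have "\<theta> * ((D - 1) * (S - R)) \<ge> 0"
    using gap unfolding total_norm_gap[symmetric] by (simp add: S_def S1_def S2_def D_def)
  then have "\<theta> * (D - 1) * (ln S - ln R) \<ge> 0"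
    using pos R by (intro ln_diff_sign) (simp_all add: mult.assoc)
  moreover have "\<alpha> / (1 - \<alpha>) = (D - 1) * (\<alpha> / ((1 - \<alpha>) * (D - 1)))" "\<alpha> / ((1 - \<alpha>) * (D - 1)) > 0"
    using \<alpha> D1 by (auto simp: zero_less_divide_iff zero_less_mult_iff)
  ultimately have "\<alpha> / ((1 - \<alpha>) * (D - 1)) * (\<theta> * (D - 1) * (ln S - ln R)) \<ge> 0"
    by (simp only: zero_le_mult_iff) auto
  moreover have "\<theta> * (\<alpha> / (1 - \<alpha>) * (ln S - ln R)) = \<alpha> / ((1 - \<alpha>) * (D - 1)) * (\<theta> * (D - 1) * (ln S - ln R))"
    using D1(3) by simp
  ultimately show ?thesis
    unfolding E by simp
qed

section \<open>Order one as a limit\<close>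

lemma correction_term_1:
  "correction_term 1 p1 p2 = arimoto_entropy 1 p1 + arimoto_entropy 1 p2
     - arimoto_entropy 1 p1 * arimoto_entropy 1 p2 / ln 2"
  using tendsto_Lim[OF _ correction_formula_tendsto[of p1 p2]] by (simp add: correction_term_def)

text \<open>At order one all terms are limits, and the weak inequality is passed to the limit from
  the right; therefore \<open>gap\<close> is assumed for all orders above one when
  \<open>\<alpha> = 1\<close>.\<close>

lemma entropy_gap_sign_all:
  fixes p1 :: "(bit \<times> 'y1::finite) pmf" and p2 :: "(bit \<times> 'y2::finite) pmf"
  assumes \<alpha>: "\<alpha> > 0"
    and gap: "\<And>a. a > 0 \<Longrightarrow> a = \<alpha> \<or> (\<alpha> = 1 \<and> a > 1) \<Longrightarrow> \<theta> * (\<Sum>y1\<in>UNIV. \<Sum>y2\<in>UNIV.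
      gap a (pmf p1 (0, y1)) (pmf p1 (1, y1)) (pmf p2 (0, y2)) (pmf p2 (1, y2))) \<ge> 0"
  shows "\<theta> * (arimoto_entropy \<alpha> (sum_given_pmf p1 p2)
      - (arimoto_entropy \<alpha> p1 + arimoto_entropy \<alpha> p2 - correction_term \<alpha> p1 p2)) \<ge> 0"
proof (cases "\<alpha> = 1")
  case False
  then show ?thesis
    using entropy_gap_sign[OF \<alpha> False gap] \<alpha> by (simp add: arimoto_entropy_def correction_term_def)
next
  case True
  let ?E = "\<lambda>a. \<theta> * (arimoto_formula (sum_given_pmf p1 p2) a
      - (arimoto_formula p1 a + arimoto_formula p2 a - correction_formula p1 p2 a))"
  have lim: "(arimoto_formula p \<longlongrightarrow> arimoto_entropy 1 p) (at_right 1)" for p :: "('x::finite \<times> 'y::finite) pmf"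
    unfolding arimoto_entropy_1 by (rule tendsto_within_subset[OF arimoto_formula_tendsto]) auto
  have "(correction_formula p1 p2 \<longlongrightarrow> correction_term 1 p1 p2) (at_right 1)"
    unfolding correction_term_1 by (rule tendsto_within_subset[OF correction_formula_tendsto]) auto
  then have "(?E \<longlongrightarrow> \<theta> * (arimoto_entropy 1 (sum_given_pmf p1 p2)
      - (arimoto_entropy 1 p1 + arimoto_entropy 1 p2 - correction_term 1 p1 p2))) (at_right 1)"
    by (intro tendsto_intros lim)
  moreover have "\<forall>\<^sub>F a in at_right 1. ?E a \<ge> 0"
    using eventually_at_right_less[of 1]
  proof eventually_elim
    case (elim a)
    then show ?case
      using True by (intro entropy_gap_sign gap) auto
  qed
  ultimately show ?thesis
    unfolding True by (rule tendsto_lowerbound) simp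
qed

text \<open>An erasure leaves both inputs equally likely, and any other output determines the input;
  this is the condition in \<open>gap_eq_0\<close>.\<close>

lemma bec_pmf_symmetric_or_certain:
  "pmf (bec_pmf \<epsilon>) (0, y) = 0 \<or> pmf (bec_pmf \<epsilon>) (1, y) = 0 \<or> pmf (bec_pmf \<epsilon>) (0, y) = pmf (bec_pmf \<epsilon>) (1, y)"
proof (cases y)
  case None
  have "pmf (bec_pmf \<epsilon>) (x, None) = pmf (pmf_of_set (UNIV :: bit set)) x * pmf (bernoulli_pmf \<epsilon>) True" for x
  proof -
    have "(\<lambda>(x :: bit, erased). (x, if erased then None else Some x)) -` {(x, None)} = {(x, True)}"
      by (auto split: if_splits)
    then show ?thesis
      unfolding bec_pmf_def pmf_map by (simp only: measure_pmf_single pmf_pair)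
  qed
  then show ?thesis
    using None by simp
next
  case (Some x')
  have "pmf (bec_pmf \<epsilon>) (x, Some x') = 0" if "x \<noteq> x'" for x
    using that by (auto simp: bec_pmf_def pmf_eq_0_set_pmf split: if_splits)
  then show ?thesis
    using Some by (cases x') auto
qed

theorem mainTheorem4:
  fixes p1 :: "(bit \<times> 'y1::finite) pmf" and p2 :: "(bit \<times> 'y2::finite) pmf"
  shows "(\<forall>\<alpha>::real. \<alpha> \<in> {0<..1/3} \<union> {1/2..} \<longrightarrow>
            arimoto_entropy \<alpha> (sum_given_pmf p1 p2) \<ge>
              arimoto_entropy \<alpha> p1 + arimoto_entropy \<alpha> p2 - correction_term \<alpha> p1 p2)
       \<and> arimoto_entropy 1 p1 + arimoto_entropy 1 p2 - correction_term 1 p1 p2 =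
            arimoto_entropy 1 p1 * arimoto_entropy 1 p2 / ln 2
       \<and> (\<forall>\<alpha>::real. \<alpha> \<in> {1/3..1/2} \<longrightarrow>
            arimoto_entropy \<alpha> (sum_given_pmf p1 p2) \<le>
              arimoto_entropy \<alpha> p1 + arimoto_entropy \<alpha> p2 - correction_term \<alpha> p1 p2)
       \<and> (\<forall>\<alpha>::real. \<alpha> \<in> {1/3, 1/2} \<longrightarrow>
            arimoto_entropy \<alpha> (sum_given_pmf p1 p2) =
              arimoto_entropy \<alpha> p1 + arimoto_entropy \<alpha> p2 - correction_term \<alpha> p1 p2)
       \<and> (\<forall>\<alpha>::real. \<forall>\<epsilon>1\<in>{0..1}. \<forall>\<epsilon>2\<in>{0..1}. \<alpha> > 0 \<longrightarrow>
            arimoto_entropy \<alpha> (sum_given_pmf (bec_pmf \<epsilon>1) (bec_pmf \<epsilon>2)) =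
              arimoto_entropy \<alpha> (bec_pmf \<epsilon>1) + arimoto_entropy \<alpha> (bec_pmf \<epsilon>2)
                - correction_term \<alpha> (bec_pmf \<epsilon>1) (bec_pmf \<epsilon>2))"
proof -
  have sum_gap: "\<theta> * (\<Sum>y1\<in>UNIV. \<Sum>y2\<in>UNIV.
      gap a (pmf p1 (0, y1)) (pmf p1 (1, y1)) (pmf p2 (0, y2)) (pmf p2 (1, y2))) \<ge> 0"
    if "a > 0" "\<theta> * ((1 / a - 2) * (1 / a - 3)) \<ge> 0" for a \<theta>
    unfolding sum_distrib_left using that by (intro sum_nonneg gap_sign) auto
  have lower: "arimoto_entropy \<alpha> (sum_given_pmf p1 p2) \<ge>
      arimoto_entropy \<alpha> p1 + arimoto_entropy \<alpha> p2 - correction_term \<alpha> p1 p2"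
    if "\<alpha> \<in> {0<..1/3} \<union> {1/2..}" for \<alpha>
  proof -
    \<comment> \<open>The order \<open>a\<close> is kept separate from \<open>\<alpha>\<close>,
      because the case \<open>\<alpha> = 1\<close> uses orders above one.\<close>
    have "(1 / a - 2) * (1 / a - 3) \<ge> 0" if "a \<in> {0<..1/3} \<union> {1/2..}" for a :: real
    proof (cases "a \<le> 1/3")
      case True
      then have "1 / a \<ge> 3" using that by (simp add: field_simps)
      then show ?thesis by simp
    next
      case False
      then have "1 / a \<le> 2" using that by (simp add: field_simps)
      then show ?thesis by (simp add: mult_nonpos_nonpos)
    qed
    then have "1 * (arimoto_entropy \<alpha> (sum_given_pmf p1 p2) -
        (arimoto_entropy \<alpha> p1 + arimoto_entropy \<alpha> p2 - correction_term \<alpha> p1 p2)) \<ge> 0"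
      using that by (intro entropy_gap_sign_all sum_gap) auto
    then show ?thesis by simp
  qed
  have upper: "arimoto_entropy \<alpha> (sum_given_pmf p1 p2) \<le>
      arimoto_entropy \<alpha> p1 + arimoto_entropy \<alpha> p2 - correction_term \<alpha> p1 p2"
    if "\<alpha> \<in> {1/3..1/2}" for \<alpha>
  proof -
    have "1 / \<alpha> \<ge> 2" "1 / \<alpha> \<le> 3" using that by (simp_all add: field_simps)
    then have "- 1 * ((1 / \<alpha> - 2) * (1 / \<alpha> - 3)) \<ge> 0"
      by (simp add: mult_nonneg_nonpos)
    then have "- 1 * (arimoto_entropy \<alpha> (sum_given_pmf p1 p2) -
        (arimoto_entropy \<alpha> p1 + arimoto_entropy \<alpha> p2 - correction_term \<alpha> p1 p2)) \<ge> 0"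
      using that by (intro entropy_gap_sign_all sum_gap) auto
    then show ?thesis by simp
  qed
  have bec: "arimoto_entropy \<alpha> (sum_given_pmf (bec_pmf \<epsilon>1) (bec_pmf \<epsilon>2)) =
      arimoto_entropy \<alpha> (bec_pmf \<epsilon>1) + arimoto_entropy \<alpha> (bec_pmf \<epsilon>2)
        - correction_term \<alpha> (bec_pmf \<epsilon>1) (bec_pmf \<epsilon>2)" if "\<alpha> > 0" for \<alpha> \<epsilon>1 \<epsilon>2
  proof -
    \<comment> \<open>Every gap vanishes, so \<open>\<theta>\<close> is free, and the choices 1 and
      -1 together give equality.\<close>
    have "\<theta> * (arimoto_entropy \<alpha> (sum_given_pmf (bec_pmf \<epsilon>1) (bec_pmf \<epsilon>2)) -
      (arimoto_entropy \<alpha> (bec_pmf \<epsilon>1) + arimoto_entropy \<alpha> (bec_pmf \<epsilon>2)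
        - correction_term \<alpha> (bec_pmf \<epsilon>1) (bec_pmf \<epsilon>2))) \<ge> 0" for \<theta>
      using that by (intro entropy_gap_sign_all)
        (auto simp: gap_eq_0(1)[OF _ _ _ _ _ bec_pmf_symmetric_or_certain])
    from this[of 1] this[of "- 1"] show ?thesis by simp
  qed
  \<comment> \<open>The orders 1/3 and 1/2 lie in both ranges, so the two inequalities give equality
    there.\<close>
  show ?thesis
    using lower upper bec by (auto simp: correction_term_1 intro!: antisym)
qed

end
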